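(* Let $F,\phi:\mathcal X\to\mathbb R\cup\{+\infty\}$ be proper lower semicontinuous functions such that $\inf_{x\in\mathcal X}(F+\phi)(x)>-\infty$; $F$ is locally Lipschitz continuous at every point of $\operatorname{int}(\operatorname{dom}F)$; $\operatorname{dom}F$ is convex with $\operatorname{dom}\phi\subset\operatorname{int}(\operatorname{dom}F)$; and $\phi$ is prox-bounded with threshold $\gamma_\phi\in(0,+\infty]$. Assume moreover that $F$ is lower regular at every point of $\operatorname{int}(\operatorname{dom}F)$, that $\phi$ is prox-regular at every point of $\operatorname{dom}\phi$, and that the limiting subdifferential $\partial_{\rm L}\phi$ is outer semicontinuous at every point of $\operatorname{dom}\phi$. Let $\{F^{\langle\mu\rangle}\}_{\mu\in(0,\widetilde\mu)}$ with some $\widetilde\mu\in(0,+\infty]$ be a smoothing function of $F$. Choose $\widetilde\gamma\in(0,\gamma_\phi)$ arbitrarily. For $x^\star\in\operatorname{dom}\phi$, the following conditions are equivalent: (i) $x^\star$ is a Fréchet stationary point of $F+\phi$. (ii) There exist $(x_n)_{n=1}^\infty\subset\operatorname{int}(\operatorname{dom}F)$ with $\lim_{n\to\infty}x_n=x^\star$, a sequence $(\mu_n)_{n=1}^\infty\subset(0,\widetilde\mu)$ with $\mu_n\searrow0$, and $(\gamma_n)_{n=1}^\infty\subset(0,\widetilde\gamma]$ such that $\liminf_{n\to\infty}\mathcal M_{\gamma_n}^{F^{\langle\mu_n\rangle},\phi}(x_n)=0$.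
   Context: $\mathcal X$ is a (finite-dimensional real) Euclidean space with inner product $\langle\cdot,\cdot\rangle$ and norm $\|\cdot\|$; $B(\bar x,\delta)$ is the open ball; $\operatorname{dom}\psi=\{x:\psi(x)<+\infty\}$; proper means $\operatorname{dom}\psi\neq\emptyset$. A function is locally Lipschitz continuous at $\bar x$ if it is Lipschitz continuous on some open neighborhood of $\bar x$. $\phi$ is prox-bounded with threshold $\gamma_\phi\in(0,+\infty]$ if $\phi+\frac1{2\gamma}\|\cdot\|^2$ is bounded below for all $\gamma\in(0,\gamma_\phi)$. $\mu_n\searrow0$ means $(\mu_n)$ is monotonically nonincreasing with limit $0$. Subdifferentials of $\psi:\mathcal X\to\mathbb R\cup\{+\infty\}$ at $\bar x\in\operatorname{dom}\psi$ (empty if $\bar x\notin\operatorname{dom}\psi$): - Fréchet: $v\in\partial_{\rm F}\psi(\bar x)$ if $\liminf_{x\to\bar x,\,x\ne\bar x}\frac{\psi(x)-\psi(\bar x)-\langle v,x-\bar x\rangle}{\|x-\bar x\|}\ge0$; - limiting: $v\in\partial_{\rm L}\psi(\bar x)$ if there are $x_n\to\bar x$ with $\psi(x_n)\to\psi(\bar x)$ and $v_n\in\partial_{\rm F}\psi(x_n)$ with $v_n\to v$. $x^\star\in\operatorname{dom}\phi$ is a Fréchet stationary point of $F+\phi$ if $0\in\partial_{\rm F}(F+\phi)(x^\star)$. $\psi$ is lower regular at $\bar x\in\operatorname{dom}\psi$ if $\partial_{\rm F}\psi(\bar x)=\partial_{\rm L}\psi(\bar x)$. $\psi$ is prox-regular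 at $\bar x\in\operatorname{dom}\psi$ for $\bar v\in\partial_{\rm L}\psi(\bar x)$ if there are $\delta>0$, $\eta\ge0$ such that $\psi(x')\ge\psi(x)+\langle v,x'-x\rangle-\frac\eta2\|x'-x\|^2$ for all $x'\in B(\bar x,\delta)$ whenever $x\in B(\bar x,\delta)$, $v\in\partial_{\rm L}\psi(x)\cap B(\bar v,\delta)$ and $\psi(x)<\psi(\bar x)+\delta$; $\psi$ is prox-regular at $\bar x$ if this holds for every $\bar v\in\partial_{\rm L}\psi(\bar x)$. For subsets $E_n\subset\mathcal X$, $\operatorname{Limsup}_{n\to\infty}E_n$ is the set of all $v$ that are limits of $(v_n)_{n\in N}$ with $v_n\in E_n$ along some infinite $N\subset\mathbb N$. A set-valued map $S:\mathcal X\rightrightarrows\mathcal X$ is outer semicontinuous at $\bar x$ if $\operatorname{Limsup}_{n\to\infty}S(x_n)\subset S(\bar x)$ for every sequence $x_n\to\bar x$ in $\mathcal X$. Smoothing function: a family $\{F^{\langle\mu\rangle}:\mathcal X\to\mathbb R\cup\{+\infty\}\}_{\mu\in(0,\widetilde\mu)}$ with $\operatorname{int}(\operatorname{dom}F^{\langle\mu\rangle})=\operatorname{int}(\operatorname{dom}F)$ for all $\mu$ is a smoothing function of $F$ if: (a) $\lim_{\mu\to0}F^{\langle\mu\rangle}(\bar x)=F(\bar x)$ for all $\bar x\in\operatorname{int}(\operatorname{dom}F)$; (b) there is $\kappa>0$ with $0\le F^{\langle\mu'\rangle}(x)-F^{\langle\mu\rangle}(x)\le\kappa(\mu-\mu')$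 for all $\mu,\mu'\in(0,\widetilde\mu)$ with $\mu'\le\mu$ and all $x\in\operatorname{int}(\operatorname{dom}F)$; (c) for every $\mu\in(0,\widetilde\mu)$, $F^{\langle\mu\rangle}$ is continuously differentiable over $\operatorname{int}(\operatorname{dom}F)$ and $\nabla F^{\langle\mu\rangle}$ is Lipschitz continuous over $\operatorname{int}(\operatorname{dom}F)$ with a constant $L_{\nabla F^{\langle\mu\rangle}}>0$; (d) there are $\varpi_1\ge0$, $\varpi_2>0$ such that the constant in (c) is given by $L_{\nabla F^{\langle\mu\rangle}}=\varpi_1+\varpi_2\mu^{-1}$ for all $\mu\in(0,\widetilde\mu)$; (e) for every $\bar x\in\operatorname{int}(\operatorname{dom}F)$, $\partial_{\rm L}F(\bar x)$ equals the set of all $v\in\mathcal X$ for which there exist $(x_n)\subset\operatorname{int}(\operatorname{dom}F)$ and $(\mu_n)\subset(0,\widetilde\mu)$ with $x_n\to\bar x$, $\mu_n\searrow0$ and $v=\lim_{n\to\infty}\nabla F^{\langle\mu_n\rangle}(x_n)$. For $\gamma>0$, $\operatorname{prox}_{\gamma\phi}(\bar x)=\operatorname{argmin}_{x\in\mathcal X}\big(\phi(x)+\frac1{2\gamma}\|x-\bar x\|^2\big)$ (a set), and for $G:\mathcal X\to\mathbb R\cup\{+\infty\}$, $$\mathcal M_\gamma^{G,\phi}(\bar x)=\inf\Big\{\Big\|\frac{\bar x-p}{\gamma}\Big\| : p\in\operatorname{prox}_{\gamma\phi}(\bar x-\gamma v),\ v\in\partial_{\rm L}G(\bar x)\Big\}\in[0,+\infty]\quad(\inf\emptyset=+\infty).$$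 (For $\bar x\in\operatorname{int}(\operatorname{dom}F)$, $\partial_{\rm L}F^{\langle\mu\rangle}(\bar x)=\{\nabla F^{\langle\mu\rangle}(\bar x)\}$.) *)

theory Defs
  imports "HOL-Analysis.Analysis"
begin

text \<open>Functions into the reals extended by plus infinity are modelled as functions into
  \<^typ>\<open>ereal\<close> that never take the value minus infinity.\<close>

definition no_minus_infinity :: "('a \<Rightarrow> ereal) \<Rightarrow> bool" where
  "no_minus_infinity \<psi> \<longleftrightarrow> (\<forall>x. \<psi> x \<noteq> -\<infinity>)"

definition edom :: "('a \<Rightarrow> ereal) \<Rightarrow> 'a set" where
  "edom \<psi> = {x. \<psi> x < \<infinity>}"

definition proper_fun :: "('a \<Rightarrow> ereal) \<Rightarrow> bool" where
  "proper_fun \<psi> \<longleftrightarrow> no_minus_infinity \<psi> \<and> edom \<psi> \<noteq> {}"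

definition lower_semicontinuous :: "('a::topological_space \<Rightarrow> ereal) \<Rightarrow> bool" where
  "lower_semicontinuous \<psi> \<longleftrightarrow> (\<forall>x. \<psi> x \<le> Liminf (at x) \<psi>)"

definition locally_lipschitz_at :: "('a::metric_space \<Rightarrow> ereal) \<Rightarrow> 'a \<Rightarrow> bool" where
  "locally_lipschitz_at \<psi> x \<longleftrightarrow>
     (\<exists>U L. open U \<and> x \<in> U \<and> (\<forall>y\<in>U. \<bar>\<psi> y\<bar> \<noteq> \<infinity>) \<and>
            lipschitz_on L U (\<lambda>y. real_of_ereal (\<psi> y)))"

definition prox_bounded_with :: "('a::real_normed_vector \<Rightarrow> ereal) \<Rightarrow> ereal \<Rightarrow> bool" where
  "prox_bounded_with \<phi> \<gamma>\<phi> \<longleftrightarrow>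
     0 < \<gamma>\<phi> \<and>
     (\<forall>\<gamma>::real. 0 < \<gamma> \<and> ereal \<gamma> < \<gamma>\<phi> \<longrightarrow>
        (\<exists>m::real. \<forall>x. ereal m \<le> \<phi> x + ereal (1 / (2 * \<gamma>) * (norm x)\<^sup>2)))"

definition frechet_subdiff :: "('a::euclidean_space \<Rightarrow> ereal) \<Rightarrow> 'a \<Rightarrow> 'a set" where
  "frechet_subdiff \<psi> x =
     {v. x \<in> edom \<psi> \<and>
         0 \<le> Liminf (at x) (\<lambda>y. (\<psi> y - \<psi> x - ereal (v \<bullet> (y - x))) / ereal (norm (y - x)))}"

definition limiting_subdiff :: "('a::euclidean_space \<Rightarrow> ereal) \<Rightarrow> 'a \<Rightarrow> 'a set" where
  "limiting_subdiff \<psi> x =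
     {v. x \<in> edom \<psi> \<and>
         (\<exists>xs vs. xs \<longlonglongrightarrow> x \<and> (\<lambda>n. \<psi> (xs n)) \<longlonglongrightarrow> \<psi> x \<and>
                  (\<forall>n. vs n \<in> frechet_subdiff \<psi> (xs n)) \<and> vs \<longlonglongrightarrow> v)}"

definition frechet_stationary ::
    "('a::euclidean_space \<Rightarrow> ereal) \<Rightarrow> ('a \<Rightarrow> ereal) \<Rightarrow> 'a \<Rightarrow> bool" where
  "frechet_stationary F \<phi> x \<longleftrightarrow> x \<in> edom \<phi> \<and> 0 \<in> frechet_subdiff (\<lambda>y. F y + \<phi> y) x"

definition lower_regular_at :: "('a::euclidean_space \<Rightarrow> ereal) \<Rightarrow> 'a \<Rightarrow> bool" where
  "lower_regular_at \<psi> x \<longleftrightarrow> x \<in> edom \<psi> \<and> frechet_subdiff \<psi> x = limiting_subdiff \<psi> x"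

definition prox_regular_at_for :: "('a::euclidean_space \<Rightarrow> ereal) \<Rightarrow> 'a \<Rightarrow> 'a \<Rightarrow> bool" where
  "prox_regular_at_for \<psi> xb vb \<longleftrightarrow>
     xb \<in> edom \<psi> \<and> vb \<in> limiting_subdiff \<psi> xb \<and>
     (\<exists>\<delta>>0. \<exists>\<eta>\<ge>0. \<forall>x v.
        x \<in> ball xb \<delta> \<and> v \<in> limiting_subdiff \<psi> x \<inter> ball vb \<delta> \<and> \<psi> x < \<psi> xb + ereal \<delta> \<longrightarrow>
        (\<forall>x'\<in>ball xb \<delta>. \<psi> x' \<ge> \<psi> x + ereal (v \<bullet> (x' - x) - \<eta> / 2 * (norm (x' - x))\<^sup>2)))"

definition prox_regular_at :: "('a::euclidean_space \<Rightarrow> ereal) \<Rightarrow> 'a \<Rightarrow> bool" where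
  "prox_regular_at \<psi> x \<longleftrightarrow>
     x \<in> edom \<psi> \<and> (\<forall>v\<in>limiting_subdiff \<psi> x. prox_regular_at_for \<psi> x v)"

text \<open>The outer (Painleve-Kuratowski) limit of a sequence of sets; the infinite index set along
  which the selection converges is given by its increasing enumeration.\<close>

definition outer_limit :: "(nat \<Rightarrow> 'a::topological_space set) \<Rightarrow> 'a set" where
  "outer_limit E = {v. \<exists>r vs. strict_mono r \<and> (\<forall>k. vs k \<in> E (r k)) \<and> vs \<longlonglongrightarrow> v}"

definition outer_semicontinuous_at ::
    "('a::topological_space \<Rightarrow> 'b::topological_space set) \<Rightarrow> 'a \<Rightarrow> bool" where
  "outer_semicontinuous_at S x \<longleftrightarrow> (\<forall>xs. xs \<longlonglongrightarrow> x \<longrightarrow> outer_limit (\<lambda>n. S (xs n)) \<subseteq> S x)"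

text \<open>Differentiability and the gradient of an extended-valued function refer to its real part;
  they are only used at interior points of the domain, near which the function is finite.\<close>

definition has_grad :: "('a::euclidean_space \<Rightarrow> ereal) \<Rightarrow> 'a \<Rightarrow> 'a \<Rightarrow> bool" where
  "has_grad \<psi> x D \<longleftrightarrow> (GDERIV (\<lambda>y. real_of_ereal (\<psi> y)) x :> D)"

definition grad :: "('a::euclidean_space \<Rightarrow> ereal) \<Rightarrow> 'a \<Rightarrow> 'a" where
  "grad \<psi> x = (THE D. has_grad \<psi> x D)"

definition continuously_differentiable_over ::
    "('a::euclidean_space \<Rightarrow> ereal) \<Rightarrow> 'a set \<Rightarrow> bool" where
  "continuously_differentiable_over \<psi> U \<longleftrightarrow>
     (\<forall>x\<in>U. \<exists>D. has_grad \<psi> x D) \<and> continuous_on U (grad \<psi>)"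

definition decreases_to_zero :: "(nat \<Rightarrow> real) \<Rightarrow> bool" where
  "decreases_to_zero \<mu> \<longleftrightarrow> decseq \<mu> \<and> \<mu> \<longlonglongrightarrow> 0"

definition param_range :: "ereal \<Rightarrow> real set" where
  "param_range \<mu>t = {\<mu>. 0 < \<mu> \<and> ereal \<mu> < \<mu>t}"

text \<open>A family indexed by the interval from 0 to \<open>\<mu>t\<close> is a function of a real parameter whose
  values outside that interval are irrelevant.\<close>

definition smoothing_function ::
    "('a::euclidean_space \<Rightarrow> ereal) \<Rightarrow> ereal \<Rightarrow> (real \<Rightarrow> 'a \<Rightarrow> ereal) \<Rightarrow> bool" where
  "smoothing_function F \<mu>t Fs \<longleftrightarrow>
     (\<forall>\<mu>\<in>param_range \<mu>t. no_minus_infinity (Fs \<mu>) \<and>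
        interior (edom (Fs \<mu>)) = interior (edom F)) \<and>
     (\<forall>x\<in>interior (edom F). ((\<lambda>\<mu>. Fs \<mu> x) \<longlongrightarrow> F x) (at_right 0)) \<and>
     (\<exists>\<kappa>>0. \<forall>\<mu>\<in>param_range \<mu>t. \<forall>\<mu>'\<in>param_range \<mu>t. \<mu>' \<le> \<mu> \<longrightarrow>
        (\<forall>x\<in>interior (edom F).
           0 \<le> Fs \<mu>' x - Fs \<mu> x \<and> Fs \<mu>' x - Fs \<mu> x \<le> ereal (\<kappa> * (\<mu> - \<mu>')))) \<and>
     (\<exists>L.
        (\<forall>\<mu>\<in>param_range \<mu>t.
           continuously_differentiable_over (Fs \<mu>) (interior (edom F)) \<and>
           L \<mu> > 0 \<and> lipschitz_on (L \<mu>) (interior (edom F)) (grad (Fs \<mu>))) \<and>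
        (\<exists>w1 w2. w1 \<ge> 0 \<and> w2 > 0 \<and> (\<forall>\<mu>\<in>param_range \<mu>t. L \<mu> = w1 + w2 * inverse \<mu>))) \<and>
     (\<forall>x\<in>interior (edom F).
        limiting_subdiff F x =
          {v. \<exists>xs \<mu>s. (\<forall>n. xs n \<in> interior (edom F)) \<and> (\<forall>n. \<mu>s n \<in> param_range \<mu>t) \<and>
                      xs \<longlonglongrightarrow> x \<and> decreases_to_zero \<mu>s \<and>
                      (\<lambda>n. grad (Fs (\<mu>s n)) (xs n)) \<longlonglongrightarrow> v})"

definition prox :: "real \<Rightarrow> ('a::real_normed_vector \<Rightarrow> ereal) \<Rightarrow> 'a \<Rightarrow> 'a set" where
  "prox \<gamma> \<phi> xb =
     {p. is_arg_min (\<lambda>x. \<phi> x + ereal (1 / (2 * \<gamma>) * (norm (x - xb))\<^sup>2)) (\<lambda>_. True) p}"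

text \<open>The infimum is taken in \<^typ>\<open>ereal\<close>, where the empty set has infimum plus infinity.\<close>

definition stationarity_measure ::
    "real \<Rightarrow> ('a::euclidean_space \<Rightarrow> ereal) \<Rightarrow> ('a \<Rightarrow> ereal) \<Rightarrow> 'a \<Rightarrow> ereal" where
  "stationarity_measure \<gamma> G \<phi> xb =
     Inf {ereal (norm ((xb - p) /\<^sub>R \<gamma>)) | p v.
            p \<in> prox \<gamma> \<phi> (xb - \<gamma> *\<^sub>R v) \<and> v \<in> limiting_subdiff G xb}"

end

theory Submission
  imports Defs
begin

text \<open>If \<open>x\<close> is Frechet stationary, then for small \<open>\<mu>\<close> the function
  \<open>Fs \<mu> + \<phi> + c/2 * |_ - x|^2\<close> has a minimiser \<open>y\<close> in the interior of a small ball around \<open>x\<close>, so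
  \<open>\<phi>\<close> has at \<open>y\<close> a Frechet subgradient close to \<open>- grad (Fs \<mu>) y\<close>.  The gradients of the smoothing stay
  bounded near \<open>x\<close>, hence along a subsequence these subgradients converge to some
  \<open>- v \<in> limiting_subdiff \<phi> x\<close>.  Prox-regularity of \<open>\<phi>\<close> at \<open>x\<close> for \<open>- v\<close> then forces, for a fixed
  small \<open>\<gamma>\<close>, every point of \<open>prox \<gamma> \<phi> (y - \<gamma> * grad (Fs \<mu>) y)\<close> to lie within \<open>\<gamma>\<close> times the subgradient
  error of \<open>y\<close>, up to a constant factor.

  Conversely, Fermat's rule for the proximal points produces subgradients of \<open>\<phi>\<close> that differ from the
  negative smoothing gradients by a null sequence.  In the limit along a subsequence, gradient
  consistency of the smoothing and outer
  semicontinuity give \<open>v \<in> limiting_subdiff F x\<close> with \<open>- v \<in> limiting_subdiff \<phi> x\<close>, and both are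
  Frechet subgradients by lower regularity of \<open>F\<close> and prox-regularity of \<open>\<phi>\<close>.\<close>

subsection \<open>Subdifferential calculus\<close>

lemma edom_finiteE:
  assumes "no_minus_infinity \<psi>" "x \<in> edom \<psi>"
  obtains a where "\<psi> x = ereal a"
  using assms by (cases "\<psi> x") (auto simp: no_minus_infinity_def edom_def)

text \<open>Multiplying the difference quotient by \<open>norm (y - x)\<close> turns a nonnegative
  lower limit into affine minorants with error \<open>\<epsilon> * norm (y - x)\<close>. At
  \<open>y = x\<close> the inequality reads \<open>a \<le> a\<close>, so punctured and full
  neighbourhoods agree. This form spares later arguments the division of extended reals.\<close>

lemma frechet_subdiff_iff:
  fixes \<psi> :: "'a::euclidean_space \<Rightarrow> ereal"
  assumes x: "\<psi> x = ereal a"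
  shows "v \<in> frechet_subdiff \<psi> x \<longleftrightarrow>
    (\<forall>\<epsilon>>0. \<forall>\<^sub>F y in nhds x. ereal (a + v \<bullet> (y - x) - \<epsilon> * norm (y - x)) \<le> \<psi> y)"
proof -
  define q where "q y = (\<psi> y - \<psi> x - ereal (v \<bullet> (y - x))) / ereal (norm (y - x))" for y
  have q1: "ereal (a + v \<bullet> (y - x) - \<epsilon> * norm (y - x)) \<le> \<psi> y"
    if "ereal (-\<epsilon>) < q y" "y \<noteq> x" for y \<epsilon>
  proof (cases "\<psi> y")
    case (real r)
    have "- \<epsilon> < (r - a - v \<bullet> (y - x)) / norm (y - x)"
      using that real x by (simp add: q_def)
    then have "- \<epsilon> * norm (y - x) < r - a - v \<bullet> (y - x)"
      using that by (simp add: pos_less_divide_eq)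
    then show ?thesis using real by simp
  qed (use that x in \<open>auto simp: q_def\<close>)
  have q2: "ereal (-\<epsilon>) \<le> q y"
    if "ereal (a + v \<bullet> (y - x) - \<epsilon> * norm (y - x)) \<le> \<psi> y" "y \<noteq> x" for y \<epsilon>
  proof (cases "\<psi> y")
    case (real r)
    have "- \<epsilon> * norm (y - x) \<le> r - a - v \<bullet> (y - x)"
      using that real by simp
    then have "- \<epsilon> \<le> (r - a - v \<bullet> (y - x)) / norm (y - x)"
      using that by (simp add: pos_le_divide_eq)
    then show ?thesis using real x that by (simp add: q_def)
  qed (use that x in \<open>auto simp: q_def\<close>)
  have "v \<in> frechet_subdiff \<psi> x \<longleftrightarrow> 0 \<le> Liminf (at x) q"
    using x by (simp add: frechet_subdiff_def edom_def q_def[abs_def])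
  also have "\<dots> \<longleftrightarrow> (\<forall>\<epsilon>>0. \<forall>\<^sub>F y in nhds x. ereal (a + v \<bullet> (y - x) - \<epsilon> * norm (y - x)) \<le> \<psi> y)"
  proof (intro iffI allI impI)
    fix \<epsilon> :: real assume "0 \<le> Liminf (at x) q" "\<epsilon> > 0"
    then have "\<forall>\<^sub>F y in at x. ereal (-\<epsilon>) < q y"
      unfolding le_Liminf_iff by (auto simp: zero_ereal_def)
    then have "\<forall>\<^sub>F y in nhds x. y \<noteq> x \<longrightarrow> ereal (-\<epsilon>) < q y"
      by (simp add: eventually_at_filter)
    then show "\<forall>\<^sub>F y in nhds x. ereal (a + v \<bullet> (y - x) - \<epsilon> * norm (y - x)) \<le> \<psi> y"
      by eventually_elim (use q1 x in force)
  next
    assume *: "\<forall>\<epsilon>>0. \<forall>\<^sub>F y in nhds x. ereal (a + v \<bullet> (y - x) - \<epsilon> * norm (y - x)) \<le> \<psi> y"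
    show "0 \<le> Liminf (at x) q"
      unfolding le_Liminf_iff
    proof (intro allI impI)
      fix c :: ereal assume "c < 0"
      \<comment> \<open>A real \<open>e\<close> strictly between \<open>c\<close> and 0 serves as
        \<open>-\<epsilon>\<close>; it also supplies the strict inequality, since \<open>q2\<close>
        is non-strict.\<close>
      then obtain e where e: "c < ereal e" "ereal e < 0" using ereal_dense2 by blast
      then have "-e > 0" by (simp add: zero_ereal_def)
      with * have "\<forall>\<^sub>F y in nhds x. ereal (a + v \<bullet> (y - x) - (-e) * norm (y - x)) \<le> \<psi> y" by blast
      then have "\<forall>\<^sub>F y in nhds x. y \<noteq> x \<longrightarrow> c < q y"
        by eventually_elim (use q2[of _ "-e"] e in \<open>fastforce intro: less_le_trans\<close>)
      then show "\<forall>\<^sub>F y in at x. c < q y" by (simp add: eventually_at_filter)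
    qed
  qed
  finally show ?thesis .
qed

lemma frechet_subset_limiting_subdiff: "frechet_subdiff \<psi> x \<subseteq> limiting_subdiff \<psi> x"
proof
  fix v assume v: "v \<in> frechet_subdiff \<psi> x"
  then have "x \<in> edom \<psi>" by (simp add: frechet_subdiff_def)
  then show "v \<in> limiting_subdiff \<psi> x"
    unfolding limiting_subdiff_def
    by (intro CollectI conjI exI[of _ "\<lambda>_. x"] exI[of _ "\<lambda>_. v"]) (auto simp: v)
qed

lemma frechet_subdiff_add:
  fixes \<psi> \<phi> :: "'a::euclidean_space \<Rightarrow> ereal"
  assumes "\<psi> x = ereal a" "\<phi> x = ereal b"
    and v: "v \<in> frechet_subdiff \<psi> x" and w: "w \<in> frechet_subdiff \<phi> x"
  shows "v + w \<in> frechet_subdiff (\<lambda>y. \<psi> y + \<phi> y) x"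
proof -
  have s: "\<psi> x + \<phi> x = ereal (a + b)" using assms by simp
  show ?thesis
    unfolding frechet_subdiff_iff[of "\<lambda>y. \<psi> y + \<phi> y", OF s]
  proof (intro allI impI)
    fix \<epsilon> :: real assume "\<epsilon> > 0"
    then have e: "\<epsilon> / 2 > 0" by simp
    have "\<forall>\<^sub>F y in nhds x. ereal (a + v \<bullet> (y - x) - \<epsilon> / 2 * norm (y - x)) \<le> \<psi> y"
      using v e unfolding frechet_subdiff_iff[of \<psi>, OF assms(1)] by blast
    moreover have "\<forall>\<^sub>F y in nhds x. ereal (b + w \<bullet> (y - x) - \<epsilon> / 2 * norm (y - x)) \<le> \<phi> y"
      using w e unfolding frechet_subdiff_iff[of \<phi>, OF assms(2)] by blast
    ultimately show "\<forall>\<^sub>F y in nhds x. ereal (a + b + (v + w) \<bullet> (y - x) - \<epsilon> * norm (y - x)) \<le> \<psi> y + \<phi> y"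
    proof eventually_elim
      case (elim y)
      from add_mono[OF elim] show ?case by (simp add: inner_add_left algebra_simps)
    qed
  qed
qed

text \<open>Local minimality bounds \<open>\<phi> y\<close> below by
  \<open>\<phi> p + f p - f y\<close>, and the first-order expansion of \<open>f\<close> at
  \<open>p\<close> turns this into a minorant with slope \<open>- D\<close>.\<close>

lemma fermat_rule:
  fixes \<phi> :: "'a::euclidean_space \<Rightarrow> ereal"
  assumes \<phi>p: "\<phi> p = ereal b"
    and min: "\<forall>\<^sub>F y in nhds p. \<phi> p + ereal (f p) \<le> \<phi> y + ereal (f y)"
    and f: "GDERIV f p :> D"
  shows "- D \<in> frechet_subdiff \<phi> p"
  unfolding frechet_subdiff_iff[of \<phi>, OF \<phi>p]
proof (intro allI impI)
  fix \<epsilon> :: real assume \<epsilon>: "\<epsilon> > 0"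
  have "\<forall>\<^sub>F y in nhds p. norm (f y - f p - (y - p) \<bullet> D) \<le> \<epsilon> * norm (y - p)"
    using f \<epsilon> unfolding gderiv_def has_derivative_within_alt eventually_nhds_metric
    by (fastforce simp: dist_norm)
  with min show "\<forall>\<^sub>F y in nhds p. ereal (b + (- D) \<bullet> (y - p) - \<epsilon> * norm (y - p)) \<le> \<phi> y"
  proof eventually_elim
    case (elim y)
    then show ?case
      using \<phi>p by (cases "\<phi> y") (auto simp: inner_commute abs_le_iff)
  qed
qed

text \<open>Differentiability gives the minorant with slope \<open>D\<close> at once. For
  uniqueness, combining the expansion of \<open>f\<close> with a minorant of slope \<open>v\<close>
  makes \<open>(v - D) \<bullet> (y - x)\<close> at most a small multiple of
  \<open>norm (y - x)\<close>, which fails along the direction \<open>v - D\<close>.\<close>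

lemma frechet_subdiff_has_grad:
  fixes \<psi> :: "'a::euclidean_space \<Rightarrow> ereal"
  assumes fin: "\<forall>\<^sub>F y in nhds x. \<bar>\<psi> y\<bar> \<noteq> \<infinity>" and D: "has_grad \<psi> x D"
  shows "frechet_subdiff \<psi> x = {D}"
proof -
  define f where "f y = real_of_ereal (\<psi> y)" for y
  have f: "GDERIV f x :> D" using D by (simp add: has_grad_def f_def[abs_def])
  have eq: "\<forall>\<^sub>F y in nhds x. \<psi> y = ereal (f y)"
    using fin by eventually_elim (auto simp: f_def)
  then have x: "\<psi> x = ereal (f x)" by (rule eventually_nhds_x_imp_x)
  have der: "\<forall>\<^sub>F y in nhds x. norm (f y - f x - (y - x) \<bullet> D) \<le> \<epsilon> * norm (y - x)" if "\<epsilon> > 0" for \<epsilon>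
    using f that unfolding gderiv_def has_derivative_within_alt eventually_nhds_metric
    by (fastforce simp: dist_norm)
  have "D \<in> frechet_subdiff \<psi> x"
    unfolding frechet_subdiff_iff[of \<psi>, OF x]
  proof (intro allI impI)
    fix \<epsilon> :: real assume "\<epsilon> > 0"
    from der[OF this] eq
    show "\<forall>\<^sub>F y in nhds x. ereal (f x + D \<bullet> (y - x) - \<epsilon> * norm (y - x)) \<le> \<psi> y"
      by eventually_elim (auto simp: inner_commute abs_le_iff)
  qed
  moreover have "v = D" if v: "v \<in> frechet_subdiff \<psi> x" for v
  proof (rule ccontr)
    assume "v \<noteq> D"
    \<comment> \<open>A third of the distance: the two errors add up to
      \<open>2 * \<epsilon>\<close>, short of \<open>norm (v - D) = 3 * \<epsilon>\<close>.\<close>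
    define \<epsilon> where "\<epsilon> = norm (v - D) / 3"
    have \<epsilon>: "\<epsilon> > 0" using \<open>v \<noteq> D\<close> by (simp add: \<epsilon>_def)
    have "\<forall>\<^sub>F y in nhds x. ereal (f x + v \<bullet> (y - x) - \<epsilon> * norm (y - x)) \<le> \<psi> y"
      using v \<epsilon> unfolding frechet_subdiff_iff[of \<psi>, OF x] by blast
    with der[OF \<epsilon>] eq have "\<forall>\<^sub>F y in nhds x. (v - D) \<bullet> (y - x) \<le> 2 * \<epsilon> * norm (y - x)"
      by eventually_elim (auto simp: inner_commute abs_le_iff inner_diff_left inner_diff_right)
    then obtain d where d: "d > 0" "\<And>y. dist y x < d \<Longrightarrow> (v - D) \<bullet> (y - x) \<le> 2 * \<epsilon> * norm (y - x)"
      unfolding eventually_nhds_metric by blast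
    define t where "t = d / (2 * norm (v - D))"
    have t: "t > 0" using d(1) \<open>v \<noteq> D\<close> by (simp add: t_def)
    have "t * norm (v - D) = d / 2" using \<open>v \<noteq> D\<close> by (simp add: t_def)
    then have "dist (x + t *\<^sub>R (v - D)) x < d" using t d(1) by (simp add: dist_norm)
    from d(2)[OF this] have "t * (norm (v - D))\<^sup>2 \<le> 2 * \<epsilon> * (t * norm (v - D))"
      using t by (simp add: power2_norm_eq_inner)
    then have "norm (v - D) \<le> 2 * \<epsilon>"
      using t \<open>v \<noteq> D\<close> by (simp add: power2_eq_square)
    then show False using \<epsilon> by (simp add: \<epsilon>_def)
  qed
  ultimately show ?thesis by blast
qed

text \<open>\<open>grad\<close> is a definite description, so uniqueness has to be shown: two
  candidates induce the same derivative, and evaluating it at their difference shows that they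
  agree.\<close>

lemma has_grad_grad:
  assumes "has_grad \<psi> x D"
  shows "has_grad \<psi> x (grad \<psi> x)"
proof -
  have "D' = D" if "has_grad \<psi> x D'" for D'
  proof -
    have "(\<lambda>h. h \<bullet> D') = (\<lambda>h. h \<bullet> D)"
      using that assms unfolding has_grad_def gderiv_def by (rule has_derivative_unique)
    then have "(D' - D) \<bullet> D' = (D' - D) \<bullet> D" by (rule fun_cong)
    then have "(D' - D) \<bullet> (D' - D) = 0" by (simp add: inner_diff_right)
    then show ?thesis by simp
  qed
  then show ?thesis unfolding grad_def by (rule theI[where P = "has_grad \<psi> x", OF assms])
qed

text \<open>Near \<open>x\<close> every Frechet subdifferential is the singleton of the gradient, so
  continuity of the gradient determines every limit of subgradients.\<close>

lemma limiting_subdiff_continuously_differentiable: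
  fixes \<psi> :: "'a::euclidean_space \<Rightarrow> ereal"
  assumes U: "open U" "x \<in> U" and fin: "\<And>y. y \<in> U \<Longrightarrow> \<bar>\<psi> y\<bar> \<noteq> \<infinity>"
    and C1: "continuously_differentiable_over \<psi> U"
  shows "limiting_subdiff \<psi> x = {grad \<psi> x}"
proof -
  have fr: "frechet_subdiff \<psi> y = {grad \<psi> y}" if "y \<in> U" for y
  proof -
    have "\<forall>\<^sub>F z in nhds y. \<bar>\<psi> z\<bar> \<noteq> \<infinity>"
      using eventually_nhds_in_open[OF U(1) that] by eventually_elim (use fin in auto)
    then show ?thesis
      using C1 that has_grad_grad frechet_subdiff_has_grad
      unfolding continuously_differentiable_over_def by blast
  qed
  have "v = grad \<psi> x" if "v \<in> limiting_subdiff \<psi> x" for v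
  proof -
    obtain xs vs where xs: "xs \<longlonglongrightarrow> x" "\<forall>n. vs n \<in> frechet_subdiff \<psi> (xs n)" "vs \<longlonglongrightarrow> v"
      using \<open>v \<in> limiting_subdiff \<psi> x\<close> by (auto simp: limiting_subdiff_def)
    have "grad \<psi> (xs n) = vs n" if "xs n \<in> U" for n
      using xs(2)[rule_format, of n] fr[OF that] by simp
    moreover have "\<forall>\<^sub>F n in sequentially. xs n \<in> U"
      using xs(1) U by (rule topological_tendstoD)
    ultimately have "\<forall>\<^sub>F n in sequentially. grad \<psi> (xs n) = vs n"
      by (rule eventually_mono[rotated])
    moreover have "(\<lambda>n. grad \<psi> (xs n)) \<longlonglongrightarrow> grad \<psi> x"
    proof -
      have "isCont (grad \<psi>) x"
        using C1 U continuous_on_eq_continuous_at[OF U(1)]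
        unfolding continuously_differentiable_over_def by blast
      then show ?thesis using xs(1) by (rule isCont_tendsto_compose)
    qed
    ultimately have "vs \<longlonglongrightarrow> grad \<psi> x" using Lim_transform_eventually by fast
    then show ?thesis using xs(3) by (simp add: LIMSEQ_unique)
  qed
  then show ?thesis using frechet_subset_limiting_subdiff[of \<psi> x] fr[OF U(2)] by blast
qed

section \<open>Consequences of lower semicontinuity and prox-regularity\<close>

lemma lower_semicontinuous_eventually:
  assumes "lower_semicontinuous \<psi>" "c < \<psi> x"
  shows "\<forall>\<^sub>F y in nhds x. c < \<psi> y"
proof -
  have "\<forall>\<^sub>F y in at x. c < \<psi> y"
    using assms unfolding lower_semicontinuous_def le_Liminf_iff by blast
  then have "\<forall>\<^sub>F y in nhds x. y \<noteq> x \<longrightarrow> c < \<psi> y" by (simp add: eventually_at_filter)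
  then show ?thesis by eventually_elim (use assms in auto)
qed

text \<open>Without a minimiser, every point of \<open>K\<close> would have a neighbourhood on which
  a single competitor is strictly better, by lower semicontinuity. The best competitor from a finite
  subcover is then itself beaten by another one of them.\<close>

lemma lower_semicontinuous_plus_continuous_attains_inf:
  fixes \<phi> :: "'a::metric_space \<Rightarrow> ereal" and f :: "'a \<Rightarrow> real"
  assumes K: "compact K" "K \<noteq> {}" and \<phi>: "no_minus_infinity \<phi>" "lower_semicontinuous \<phi>"
    and f: "continuous_on K f"
  shows "\<exists>x\<in>K. \<forall>y\<in>K. \<phi> x + ereal (f x) \<le> \<phi> y + ereal (f y)"
proof (rule ccontr)
  define h where "h x = \<phi> x + ereal (f x)" for x
  assume "\<not> ?thesis"
  then have ex: "\<exists>y\<in>K. h y < h x" if "x \<in> K" for x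
    using that unfolding h_def by (meson not_le)
  have lsc: "\<exists>T. open T \<and> x \<in> T \<and> (\<forall>y\<in>T\<inter>K. h z < h y)" if x: "x \<in> K" and z: "h z < h x" for x z
  proof -
    have "h z \<noteq> -\<infinity>" using \<phi>(1) by (cases "\<phi> z") (auto simp: h_def no_minus_infinity_def)
    with z obtain c where c: "h z = ereal c" by (cases "h z") auto
    have "ereal (c - f x) < \<phi> x" using z c by (cases "\<phi> x") (auto simp: h_def)
    \<comment> \<open>The real \<open>d\<close> splits the strict inequality into
      \<open>d < \<phi> y\<close> and \<open>c - d < f y\<close>; both persist near \<open>x\<close>
      within \<open>K\<close> and add up to \<open>c < h y\<close>.\<close>
    then obtain d where d: "ereal (c - f x) < ereal d" "ereal d < \<phi> x"
      using ereal_dense2 by blast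
    then have "\<forall>\<^sub>F y in nhds x. ereal d < \<phi> y"
      using lower_semicontinuous_eventually[OF \<phi>(2)] by blast
    then obtain S where S: "open S" "x \<in> S" "\<forall>y\<in>S. ereal d < \<phi> y"
      unfolding eventually_nhds by blast
    have "f x \<in> {c - d<..}" using d by simp
    then obtain T where T: "open T" "x \<in> T" "\<forall>y\<in>K. y \<in> T \<longrightarrow> f y \<in> {c - d<..}"
      using f x open_greaterThan[of "c - d"] unfolding continuous_on_topological by blast
    have "h z < h y" if "y \<in> S \<inter> T \<inter> K" for y
    proof -
      have "ereal d < \<phi> y" "c - d < f y" using that S T by auto
      then show ?thesis using c by (cases "\<phi> y") (auto simp: h_def)
    qed
    then show ?thesis using S T by (intro exI[of _ "S \<inter> T"]) auto
  qed
  have "\<forall>x\<in>K. \<exists>z T. z \<in> K \<and> open T \<and> x \<in> T \<and> (\<forall>y\<in>T\<inter>K. h z < h y)"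
  proof
    fix x assume x: "x \<in> K"
    with ex obtain z where "z \<in> K" "h z < h x" by blast
    with lsc[OF x] show "\<exists>z T. z \<in> K \<and> open T \<and> x \<in> T \<and> (\<forall>y\<in>T\<inter>K. h z < h y)"
      by blast
  qed
  from bchoice[OF this] obtain z
    where "\<forall>x\<in>K. \<exists>T. z x \<in> K \<and> open T \<and> x \<in> T \<and> (\<forall>y\<in>T\<inter>K. h (z x) < h y)" ..
  from bchoice[OF this] obtain T
    where zT: "\<forall>x\<in>K. z x \<in> K \<and> open (T x) \<and> x \<in> T x \<and> (\<forall>y\<in>T x\<inter>K. h (z x) < h y)" ..
  obtain C where C: "C \<subseteq> K" "finite C" "K \<subseteq> (\<Union>c\<in>C. T c)"
  proof (rule compactE_image[OF K(1)])
    show "K \<subseteq> (\<Union>c\<in>K. T c)" using zT by auto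
  qed (use zT in auto)
  then have "C \<noteq> {}" using K(2) by auto
  define m where "m = Min ((\<lambda>c. h (z c)) ` C)"
  have "m \<in> (\<lambda>c. h (z c)) ` C"
    unfolding m_def using C(2) \<open>C \<noteq> {}\<close> by (intro Min_in) auto
  then obtain c where c: "c \<in> C" "m = h (z c)" by auto
  then have "z c \<in> K" using zT C(1) by auto
  \<comment> \<open>The point \<open>z c\<close> lies in some \<open>T c'\<close>, whose competitor
    \<open>z c'\<close> has a value below the minimum \<open>m\<close>.\<close>
  then obtain c' where c': "c' \<in> C" "z c \<in> T c'" using C(3) by auto
  then have "h (z c') < h (z c)" using zT C(1) \<open>z c \<in> K\<close> by auto
  moreover have "m \<le> h (z c')" unfolding m_def using C(2) c' by auto
  ultimately show False using c by simp
qed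

text \<open>The prox-regularity inequality taken at the base point itself is a minorant with
  quadratic error, and a quadratic error is eventually below
  \<open>\<epsilon> * norm (y - x)\<close>.\<close>

lemma prox_regular_limiting_subset_frechet:
  fixes \<psi> :: "'a::euclidean_space \<Rightarrow> ereal"
  assumes pr: "prox_regular_at \<psi> x" and x: "\<psi> x = ereal a"
  shows "limiting_subdiff \<psi> x \<subseteq> frechet_subdiff \<psi> x"
proof
  fix v assume v: "v \<in> limiting_subdiff \<psi> x"
  then have "prox_regular_at_for \<psi> x v" using pr by (simp add: prox_regular_at_def)
  then obtain \<delta> \<eta> where \<delta>: "\<delta> > 0" "\<eta> \<ge> 0"
    and ineq: "\<And>y. y \<in> ball x \<delta> \<Longrightarrow> \<psi> y \<ge> \<psi> x + ereal (v \<bullet> (y - x) - \<eta> / 2 * (norm (y - x))\<^sup>2)"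
    unfolding prox_regular_at_for_def
  proof (elim conjE exE)
    fix \<delta> \<eta> :: real
    assume *: "\<delta> > 0" "\<eta> \<ge> 0"
      "\<forall>y w. y \<in> ball x \<delta> \<and> w \<in> limiting_subdiff \<psi> y \<inter> ball v \<delta> \<and> \<psi> y < \<psi> x + ereal \<delta> \<longrightarrow>
        (\<forall>x'\<in>ball x \<delta>. \<psi> x' \<ge> \<psi> y + ereal (w \<bullet> (x' - y) - \<eta> / 2 * (norm (x' - y))\<^sup>2))"
    have "\<psi> x < \<psi> x + ereal \<delta>" using x * by simp
    then show thesis using that[OF *(1,2)] *(1) *(3)[rule_format, of x v] v by auto
  qed
  show "v \<in> frechet_subdiff \<psi> x"
    unfolding frechet_subdiff_iff[of \<psi>, OF x]
  proof (intro allI impI)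
    fix \<epsilon> :: real assume \<epsilon>: "\<epsilon> > 0"
    define d where "d = min \<delta> (\<epsilon> / (\<eta> + 1))"
    have d: "d > 0" using \<delta> \<epsilon> by (simp add: d_def)
    have "ereal (a + v \<bullet> (y - x) - \<epsilon> * norm (y - x)) \<le> \<psi> y" if y: "dist y x < d" for y
    proof -
      have "y \<in> ball x \<delta>" using y by (simp add: d_def dist_commute)
      have "norm (y - x) \<le> \<epsilon> / (\<eta> + 1)" using y by (simp add: d_def dist_norm)
      then have "norm (y - x) * (\<eta> + 1) \<le> \<epsilon>" using \<delta> by (simp add: pos_le_divide_eq)
      moreover have "\<eta> / 2 * norm (y - x) \<le> norm (y - x) * (\<eta> + 1)"
        using \<delta> by (simp add: algebra_simps)
      ultimately have "\<eta> / 2 * norm (y - x) * norm (y - x) \<le> \<epsilon> * norm (y - x)"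
        by (intro mult_right_mono) auto
      then have "ereal (a + v \<bullet> (y - x) - \<epsilon> * norm (y - x))
        \<le> \<psi> x + ereal (v \<bullet> (y - x) - \<eta> / 2 * (norm (y - x))\<^sup>2)"
        using x by (simp add: power2_eq_square)
      then show ?thesis using ineq[OF \<open>y \<in> ball x \<delta>\<close>] by (rule order_trans)
    qed
    then show "\<forall>\<^sub>F y in nhds x. ereal (a + v \<bullet> (y - x) - \<epsilon> * norm (y - x)) \<le> \<psi> y"
      unfolding eventually_nhds_metric using d by blast
  qed
qed

subsection \<open>Proximal points\<close>

lemma GDERIV_scaled_norm_square:
  fixes z :: "'a::real_inner"
  shows "GDERIV (\<lambda>y. c / 2 * (norm (y - z))\<^sup>2) p :> c *\<^sub>R (p - z)"
  unfolding gderiv_def power2_norm_eq_inner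
  by (auto intro!: derivative_eq_intros simp: inner_commute algebra_simps)

lemma prox_le:
  assumes "p \<in> prox \<gamma> \<phi> z"
  shows "\<phi> p + ereal (1 / (2 * \<gamma>) * (norm (p - z))\<^sup>2) \<le> \<phi> y + ereal (1 / (2 * \<gamma>) * (norm (y - z))\<^sup>2)"
  using assms by (simp add: prox_def is_arg_min_def not_less)

lemma prox_in_edom:
  assumes "p \<in> prox \<gamma> \<phi> z" "x0 \<in> edom \<phi>"
  shows "p \<in> edom \<phi>"
  using prox_le[OF assms(1), of x0] assms(2)
  by (cases "\<phi> p"; cases "\<phi> x0") (auto simp: edom_def)

text \<open>The quadratic term has gradient \<open>(p - x) /\<^sub>R \<gamma> + v\<close> at
  \<open>p\<close>, so Fermat's rule applies. The vector \<open>(x - p) /\<^sub>R \<gamma>\<close>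
  is the residual whose norm enters the stationarity measure.\<close>

lemma prox_fermat_rule:
  fixes \<phi> :: "'a::euclidean_space \<Rightarrow> ereal"
  assumes p: "p \<in> prox \<gamma> \<phi> (x - \<gamma> *\<^sub>R v)" and \<gamma>: "\<gamma> > 0" and b: "\<phi> p = ereal b"
  shows "(x - p) /\<^sub>R \<gamma> - v \<in> frechet_subdiff \<phi> p"
proof -
  define z where "z = x - \<gamma> *\<^sub>R v"
  have "\<forall>\<^sub>F y in nhds p. \<phi> p + ereal ((1 / \<gamma>) / 2 * (norm (p - z))\<^sup>2)
      \<le> \<phi> y + ereal ((1 / \<gamma>) / 2 * (norm (y - z))\<^sup>2)"
    using prox_le[OF p] by (simp add: z_def mult.commute)
  from fermat_rule[where \<phi> = \<phi>, OF b this GDERIV_scaled_norm_square]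
  have "- ((1 / \<gamma>) *\<^sub>R (p - z)) \<in> frechet_subdiff \<phi> p" .
  also have "- ((1 / \<gamma>) *\<^sub>R (p - z)) = (x - p) /\<^sub>R \<gamma> - v"
    using \<gamma> by (simp add: z_def algebra_simps divide_inverse)
  finally show ?thesis .
qed

text \<open>Comparing the objective at \<open>p\<close> with its value at \<open>x\<close> and
  expanding the square about \<open>x\<close> cancels the common term
  \<open>(norm (\<gamma> *\<^sub>R v))\<^sup>2\<close>.\<close>

lemma prox_descent:
  fixes \<phi> :: "'a::euclidean_space \<Rightarrow> ereal"
  assumes p: "p \<in> prox \<gamma> \<phi> (x - \<gamma> *\<^sub>R v)" and \<gamma>: "\<gamma> > 0"
    and a: "\<phi> p = ereal a" and b: "\<phi> x = ereal b"
  shows "a + v \<bullet> (p - x) + (norm (p - x))\<^sup>2 / (2 * \<gamma>) \<le> b"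
proof -
  have e: "(norm (p - (x - \<gamma> *\<^sub>R v)))\<^sup>2 = (norm (p - x))\<^sup>2 + 2 * \<gamma> * (v \<bullet> (p - x)) + (norm (\<gamma> *\<^sub>R v))\<^sup>2"
    unfolding power2_norm_eq_inner by (simp add: inner_diff inner_commute algebra_simps)
  have "a + 1 / (2 * \<gamma>) * (norm (p - (x - \<gamma> *\<^sub>R v)))\<^sup>2 \<le> b + 1 / (2 * \<gamma>) * (norm (\<gamma> *\<^sub>R v))\<^sup>2"
    using prox_le[OF p, of x] a b by simp
  moreover have "1 / (2 * \<gamma>) * (A + 2 * \<gamma> * B + C) = A / (2 * \<gamma>) + B + 1 / (2 * \<gamma>) * C" for A B C
    using \<gamma> by (simp add: field_simps)
  ultimately show ?thesis unfolding e by simp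
qed

text \<open>A rearrangement of \<open>0 \<le> (norm (x - 2 *\<^sub>R z))\<^sup>2\<close>; it moves
  the centre of a quadratic bound from the origin to another point.\<close>

lemma norm_square_le_twice:
  fixes x z :: "'a::real_inner"
  shows "(norm x)\<^sup>2 \<le> 2 * (norm (x - z))\<^sup>2 + 2 * (norm z)\<^sup>2"
proof -
  have "0 \<le> (norm (x - 2 *\<^sub>R z))\<^sup>2" by simp
  then show ?thesis
    unfolding power2_norm_eq_inner by (simp add: inner_diff inner_commute algebra_simps)
qed

text \<open>By \<open>\<gamma> \<le> \<gamma>' / 4\<close>, half of the proximal quadratic absorbs
  the possible quadratic decrease of \<open>\<phi>\<close> and the other half remains. Outside a
  large ball the objective is therefore at least its value at \<open>x0\<close>, and a minimiser
  over that compact ball is global.\<close>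

lemma prox_nonempty:
  fixes \<phi> :: "'a::euclidean_space \<Rightarrow> ereal"
  assumes \<phi>: "no_minus_infinity \<phi>" "lower_semicontinuous \<phi>" and x0: "x0 \<in> edom \<phi>"
    and low: "\<And>x. ereal m \<le> \<phi> x + ereal (1 / (2 * \<gamma>') * (norm x)\<^sup>2)"
    and \<gamma>: "0 < \<gamma>" "\<gamma> \<le> \<gamma>' / 4"
  shows "prox \<gamma> \<phi> z \<noteq> {}"
proof -
  obtain b where b: "\<phi> x0 = ereal b" using edom_finiteE[OF \<phi>(1) x0] .
  define f where "f x = 1 / (2 * \<gamma>) * (norm (x - z))\<^sup>2" for x
  define A where "A = b + f x0"
  \<comment> \<open>At \<open>(norm (y - z))\<^sup>2 = C\<close> the remaining half
    \<open>(norm (y - z))\<^sup>2 / (4 * \<gamma>)\<close> makes up for all constants.\<close>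
  define C where "C = 4 * \<gamma> * (A - m + (norm z)\<^sup>2 / \<gamma>')"
  \<comment> \<open>A radius of at least 1 puts the norm below its square, so a norm above
    \<open>C\<close> suffices; the ball also contains \<open>x0\<close>.\<close>
  define R where "R = max 1 (max C (dist z x0))"
  have "compact (cball z R)" "cball z R \<noteq> {}" by (auto simp: R_def)
  moreover have "continuous_on (cball z R) f" unfolding f_def by (intro continuous_intros)
  ultimately obtain p where p: "p \<in> cball z R"
    "\<And>y. y \<in> cball z R \<Longrightarrow> \<phi> p + ereal (f p) \<le> \<phi> y + ereal (f y)"
    using lower_semicontinuous_plus_continuous_attains_inf[OF _ _ \<phi>] by metis
  have pA: "\<phi> p + ereal (f p) \<le> ereal A"
    using p(2)[of x0] b by (simp add: A_def R_def)
  have "\<phi> p + ereal (f p) \<le> \<phi> y + ereal (f y)" for y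
  proof (cases "y \<in> cball z R")
    case False
    then have R: "norm (y - z) > R" by (simp add: dist_norm norm_minus_commute)
    then have "norm (y - z) > 1" by (simp add: R_def)
    then have "norm (y - z) \<le> (norm (y - z))\<^sup>2"
      using self_le_power[of "norm (y - z)" 2] by simp
    moreover have "C < norm (y - z)" using R by (simp add: R_def)
    ultimately have C: "C < (norm (y - z))\<^sup>2" by simp
    have "ereal A \<le> \<phi> y + ereal (f y)"
    proof (cases "\<phi> y")
      case (real s)
      have "m \<le> s + 1 / (2 * \<gamma>') * (norm y)\<^sup>2" using low[of y] real by simp
      also have "\<dots> \<le> s + 1 / (2 * \<gamma>') * (2 * (norm (y - z))\<^sup>2 + 2 * (norm z)\<^sup>2)"
        using \<gamma> norm_square_le_twice[of y z] by (intro add_left_mono mult_left_mono) auto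
      also have "\<dots> = s + (norm (y - z))\<^sup>2 / \<gamma>' + (norm z)\<^sup>2 / \<gamma>'"
        using \<gamma> by (simp add: field_simps)
      also have "(norm (y - z))\<^sup>2 / \<gamma>' \<le> (norm (y - z))\<^sup>2 / (4 * \<gamma>)"
        using \<gamma> by (intro divide_left_mono) auto
      also have "\<dots> = f y - (norm (y - z))\<^sup>2 / (4 * \<gamma>)"
        using \<gamma> by (simp add: f_def field_simps)
      finally have "m - (norm z)\<^sup>2 / \<gamma>' + (norm (y - z))\<^sup>2 / (4 * \<gamma>) \<le> s + f y" by simp
      moreover have "A - m + (norm z)\<^sup>2 / \<gamma>' \<le> (norm (y - z))\<^sup>2 / (4 * \<gamma>)"
        using C \<gamma> by (simp add: C_def pos_le_divide_eq mult.commute)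
      ultimately show ?thesis using real by simp
    qed (use \<phi>(1) in \<open>auto simp: no_minus_infinity_def\<close>)
    then show ?thesis using pA by (rule order_trans[rotated])
  qed (use p in auto)
  then have "p \<in> prox \<gamma> \<phi> z" by (simp add: prox_def is_arg_min_def f_def not_less)
  then show ?thesis by blast
qed

text \<open>The descent inequality bounds \<open>d\<^sup>2 / (2 * \<gamma>)\<close> by constants
  plus multiples of \<open>d\<^sup>2\<close> that do not depend on \<open>\<gamma>\<close>, so small
  \<open>\<gamma>\<close> forces small \<open>d\<close>. The threshold is uniform over all data
  bounded by \<open>B\<close>, which later allows one \<open>\<gamma>\<close> for a whole
  sequence.\<close>

lemma prox_near:
  fixes \<phi> :: "'a::euclidean_space \<Rightarrow> ereal"
  assumes \<phi>: "no_minus_infinity \<phi>"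
    and low: "\<And>x. ereal m \<le> \<phi> x + ereal (1 / (2 * \<gamma>') * (norm x)\<^sup>2)"
    and \<gamma>': "0 < \<gamma>'" and \<delta>: "\<delta> > 0"
  obtains \<gamma>0 where "\<gamma>0 > 0"
    "\<And>\<gamma> x v p. \<lbrakk>0 < \<gamma>; \<gamma> \<le> \<gamma>0; norm x \<le> B; norm v \<le> B; \<phi> x \<le> ereal B;
      p \<in> prox \<gamma> \<phi> (x - \<gamma> *\<^sub>R v)\<rbrakk> \<Longrightarrow> norm (p - x) < \<delta>"
proof -
  define C where "C = \<bar>B - m + B\<^sup>2 / \<gamma>' + B\<^sup>2 / 2\<bar> + 1"
  \<comment> \<open>The summands \<open>1 / \<gamma>'\<close> and \<open>1 / 2\<close> absorb the
    quadratic terms from the lower bound on \<open>\<phi>\<close> and from Cauchy-Schwarz;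
    \<open>C / \<delta>\<^sup>2\<close> then leaves
    \<open>C * d\<^sup>2 < C * \<delta>\<^sup>2\<close>.\<close>
  define K where "K = C / \<delta>\<^sup>2 + 1 / \<gamma>' + 1 / 2"
  have C: "C > 0" unfolding C_def by linarith
  have K: "K > 0" unfolding K_def using C \<gamma>' \<delta> by (intro add_pos_pos divide_pos_pos) auto
  show thesis
  proof (rule that)
    show "1 / (2 * K) > 0" using K by simp
    fix \<gamma> x v p
    assume *: "0 < \<gamma>" "\<gamma> \<le> 1 / (2 * K)" "norm x \<le> B" "norm v \<le> B" "\<phi> x \<le> ereal B"
      "p \<in> prox \<gamma> \<phi> (x - \<gamma> *\<^sub>R v)"
    have x: "x \<in> edom \<phi>" using *(5) by (auto simp: edom_def)
    obtain b where b: "\<phi> x = ereal b" using edom_finiteE[OF \<phi> x] .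
    obtain a where a: "\<phi> p = ereal a" using edom_finiteE[OF \<phi> prox_in_edom[OF *(6) x]] .
    define d where "d = norm (p - x)"
    have desc: "a + v \<bullet> (p - x) + d\<^sup>2 / (2 * \<gamma>) \<le> b"
      using prox_descent[OF *(6,1) a b] by (simp add: d_def)
    have "m \<le> a + 1 / (2 * \<gamma>') * (norm p)\<^sup>2" using low[of p] a by simp
    also have "\<dots> \<le> a + 1 / (2 * \<gamma>') * (2 * d\<^sup>2 + 2 * (norm x)\<^sup>2)"
      using \<gamma>' norm_square_le_twice[of p x] unfolding d_def
      by (intro add_left_mono mult_left_mono) auto
    also have "\<dots> \<le> a + 1 / (2 * \<gamma>') * (2 * d\<^sup>2 + 2 * B\<^sup>2)"
      using \<gamma>' *(3) by (intro add_left_mono mult_left_mono power_mono) auto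
    also have "\<dots> = a + d\<^sup>2 / \<gamma>' + B\<^sup>2 / \<gamma>'" using \<gamma>' by (simp add: field_simps)
    finally have low': "m \<le> a + d\<^sup>2 / \<gamma>' + B\<^sup>2 / \<gamma>'" .
    have "- (v \<bullet> (p - x)) \<le> norm v * d"
      using Cauchy_Schwarz_ineq2[of v "p - x"] by (simp add: d_def)
    also have "\<dots> \<le> B * d" using *(4) by (intro mult_right_mono) (auto simp: d_def)
    also have "\<dots> \<le> B\<^sup>2 / 2 + d\<^sup>2 / 2" using sum_squares_bound[of B d] by simp
    finally have cs: "- (v \<bullet> (p - x)) \<le> B\<^sup>2 / 2 + d\<^sup>2 / 2" .
    have "2 * K * \<gamma> \<le> 1" using *(2) K by (simp add: pos_le_divide_eq mult.commute)
    then have "K \<le> 1 / (2 * \<gamma>)" using *(1) by (simp add: pos_le_divide_eq mult_ac)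
    then have "K * d\<^sup>2 \<le> 1 / (2 * \<gamma>) * d\<^sup>2" by (intro mult_right_mono) auto
    then have "C / \<delta>\<^sup>2 * d\<^sup>2 + d\<^sup>2 / \<gamma>' + d\<^sup>2 / 2 \<le> d\<^sup>2 / (2 * \<gamma>)"
      by (simp add: K_def algebra_simps)
    with desc low' cs have "C / \<delta>\<^sup>2 * d\<^sup>2 \<le> b - m + B\<^sup>2 / \<gamma>' + B\<^sup>2 / 2" by linarith
    also have "b \<le> B" using *(5) b by simp
    also have "B - m + B\<^sup>2 / \<gamma>' + B\<^sup>2 / 2 < C" unfolding C_def by linarith
    finally have "C / \<delta>\<^sup>2 * d\<^sup>2 < C" by simp
    then have "C * d\<^sup>2 < C * \<delta>\<^sup>2" using \<delta> by (simp add: pos_divide_less_eq)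
    then have "d\<^sup>2 < \<delta>\<^sup>2" using C by simp
    then have "d < \<delta>" using \<delta> by (auto intro: power2_less_imp_less)
    then show "norm (p - x) < \<delta>" by (simp add: d_def)
  qed
qed

subsection \<open>Smoothing functions\<close>

text \<open>Fixing \<open>\<mu>\<close> and letting \<open>\<mu>'\<close> tend to 0 in the monotone
  parameter estimate bounds the gap between \<open>F\<close> and \<open>Fs \<mu>\<close>. The two
  real bounds also show that \<open>F\<close> is finite on the interior of its domain.\<close>

lemma smoothing_function_gap:
  fixes F :: "'a::euclidean_space \<Rightarrow> ereal"
  assumes sm: "smoothing_function F \<mu>t Fs"
  obtains \<kappa> where "\<kappa> > 0" "\<And>\<mu> x. \<lbrakk>\<mu> \<in> param_range \<mu>t; x \<in> interior (edom F)\<rbrakk> \<Longrightarrow>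
    \<exists>a b. F x = ereal a \<and> Fs \<mu> x = ereal b \<and> b \<le> a \<and> a \<le> b + \<kappa> * \<mu>"
proof -
  have lim: "\<And>x. x \<in> interior (edom F) \<Longrightarrow> ((\<lambda>\<mu>. Fs \<mu> x) \<longlongrightarrow> F x) (at_right 0)"
    and dom: "\<And>\<mu>. \<mu> \<in> param_range \<mu>t \<Longrightarrow>
      no_minus_infinity (Fs \<mu>) \<and> interior (edom (Fs \<mu>)) = interior (edom F)"
    using sm unfolding smoothing_function_def by blast+
  from sm[unfolded smoothing_function_def, THEN conjunct2, THEN conjunct2, THEN conjunct1]
  obtain \<kappa> where \<kappa>: "\<kappa> > 0" and mono: "\<forall>\<mu>\<in>param_range \<mu>t. \<forall>\<mu>'\<in>param_range \<mu>t. \<mu>' \<le> \<mu> \<longrightarrow>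
        (\<forall>x\<in>interior (edom F).
           0 \<le> Fs \<mu>' x - Fs \<mu> x \<and> Fs \<mu>' x - Fs \<mu> x \<le> ereal (\<kappa> * (\<mu> - \<mu>')))"
    by blast
  have fin: "\<exists>b. Fs \<mu> x = ereal b" if "\<mu> \<in> param_range \<mu>t" "x \<in> interior (edom F)" for \<mu> x
  proof -
    have "no_minus_infinity (Fs \<mu>)" "x \<in> edom (Fs \<mu>)"
      using dom[OF that(1)] that(2) interior_subset by auto
    then obtain b where "Fs \<mu> x = ereal b" by (rule edom_finiteE)
    then show ?thesis by blast
  qed
  show thesis
  proof (rule that[OF \<kappa>])
    fix \<mu> x assume \<mu>: "\<mu> \<in> param_range \<mu>t" and x: "x \<in> interior (edom F)"
    obtain b where b: "Fs \<mu> x = ereal b" using fin[OF \<mu> x] by blast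
    have "\<mu> > 0" using \<mu> by (simp add: param_range_def)
    have ev: "ereal b \<le> Fs \<mu>' x \<and> Fs \<mu>' x \<le> ereal (b + \<kappa> * \<mu>)" if "0 < \<mu>'" "\<mu>' < \<mu>" for \<mu>'
    proof -
      have "ereal \<mu>' < \<mu>t" using \<mu> that less_trans[of "ereal \<mu>'" "ereal \<mu>" \<mu>t]
        by (simp add: param_range_def)
      then have \<mu>': "\<mu>' \<in> param_range \<mu>t" using that by (simp add: param_range_def)
      obtain b' where b': "Fs \<mu>' x = ereal b'" using fin[OF \<mu>' x] by blast
      have "0 \<le> b' - b" "b' - b \<le> \<kappa> * (\<mu> - \<mu>')"
        using mono[rule_format, OF \<mu> \<mu>' _ x] that b b' by auto
      moreover have "\<kappa> * (\<mu> - \<mu>') \<le> \<kappa> * \<mu>" using \<kappa> that by simp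
      ultimately show ?thesis using b' by simp
    qed
    have ev': "\<forall>\<^sub>F \<mu>' in at_right 0. ereal b \<le> Fs \<mu>' x \<and> Fs \<mu>' x \<le> ereal (b + \<kappa> * \<mu>)"
      using eventually_at_right_real[OF \<open>\<mu> > 0\<close>] by eventually_elim (use ev in auto)
    have "ereal b \<le> F x"
      by (rule tendsto_lowerbound[OF lim[OF x]]) (use ev' in \<open>auto elim: eventually_mono\<close>)
    moreover have "F x \<le> ereal (b + \<kappa> * \<mu>)"
      by (rule tendsto_upperbound[OF lim[OF x]]) (use ev' in \<open>auto elim: eventually_mono\<close>)
    ultimately show "\<exists>a b. F x = ereal a \<and> Fs \<mu> x = ereal b \<and> b \<le> a \<and> a \<le> b + \<kappa> * \<mu>"
      using b by (cases "F x") auto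
  qed
qed

lemma smoothing_function_GDERIV:
  assumes "smoothing_function F \<mu>t Fs" "\<mu> \<in> param_range \<mu>t" "x \<in> interior (edom F)"
  shows "GDERIV (\<lambda>y. real_of_ereal (Fs \<mu> y)) x :> grad (Fs \<mu>) x"
proof -
  have "\<exists>D. has_grad (Fs \<mu>) x D"
    using assms unfolding smoothing_function_def continuously_differentiable_over_def by blast
  then show ?thesis using has_grad_grad unfolding has_grad_def by blast
qed

text \<open>By the mean value theorem, a step of length \<open>\<mu>\<close> along the normalised gradient raises \<open>Fs \<mu>\<close> by at
  least \<open>\<mu> * (norm (grad (Fs \<mu>) y) - w1 * \<mu> - w2)\<close>, because the Lipschitz constant of the gradient is of
  order \<open>1 / \<mu>\<close>; since \<open>Fs \<mu>\<close> is within \<open>\<kappa> * \<mu>\<close> of \<open>F\<close>, it rises by at most \<open>(K + \<kappa>) * \<mu>\<close>.\<close>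

lemma smoothing_gradient_bounded:
  fixes F :: "'a::euclidean_space \<Rightarrow> ereal"
  assumes sm: "smoothing_function F \<mu>t Fs" and lip: "locally_lipschitz_at F x"
    and x: "x \<in> interior (edom F)"
  obtains r M where "r > 0"
    "\<And>y \<mu>. \<lbrakk>y \<in> ball x r; \<mu> \<in> param_range \<mu>t; \<mu> \<le> r\<rbrakk> \<Longrightarrow> norm (grad (Fs \<mu>) y) \<le> M"
proof -
  obtain \<kappa> where \<kappa>: "\<kappa> > 0" and gap: "\<And>\<mu> x. \<lbrakk>\<mu> \<in> param_range \<mu>t; x \<in> interior (edom F)\<rbrakk> \<Longrightarrow>
    \<exists>a b. F x = ereal a \<and> Fs \<mu> x = ereal b \<and> b \<le> a \<and> a \<le> b + \<kappa> * \<mu>"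
    using smoothing_function_gap[OF sm] by blast
  obtain w1 w2 where w: "w1 \<ge> 0" "w2 > 0" and L: "\<And>\<mu>. \<mu> \<in> param_range \<mu>t \<Longrightarrow>
    lipschitz_on (w1 + w2 * inverse \<mu>) (interior (edom F)) (grad (Fs \<mu>))"
  proof -
    from sm[unfolded smoothing_function_def, THEN conjunct2, THEN conjunct2, THEN conjunct2, THEN conjunct1]
    obtain L w1 w2 where "w1 \<ge> 0" "w2 > 0"
      "\<forall>\<mu>\<in>param_range \<mu>t. lipschitz_on (L \<mu>) (interior (edom F)) (grad (Fs \<mu>))"
      "\<forall>\<mu>\<in>param_range \<mu>t. L \<mu> = w1 + w2 * inverse \<mu>"
      by blast
    then show thesis using that[of w1 w2] by auto
  qed
  obtain U K where U: "open U" "x \<in> U" and K: "lipschitz_on K U (\<lambda>y. real_of_ereal (F y))"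
    using lip unfolding locally_lipschitz_at_def by blast
  have "open (U \<inter> interior (edom F))" "x \<in> U \<inter> interior (edom F)" using U x by auto
  then obtain \<rho> where \<rho>: "\<rho> > 0" "ball x \<rho> \<subseteq> U \<inter> interior (edom F)"
    by (auto elim: openE)
  \<comment> \<open>Half of \<open>\<rho>\<close> leaves room for a step of length
    \<open>\<mu> \<le> r\<close> from \<open>y\<close>; the bound 1 gives
    \<open>w1 * \<mu> \<le> w1\<close>.\<close>
  define r where "r = min (\<rho> / 2) 1"
  have r: "r > 0" "r \<le> 1" "2 * r \<le> \<rho>" using \<rho> by (auto simp: r_def)
  show thesis
  proof (rule that[OF r(1)])
    fix y \<mu> assume y: "y \<in> ball x r" and \<mu>: "\<mu> \<in> param_range \<mu>t" "\<mu> \<le> r"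
    have \<mu>0: "\<mu> > 0" using \<mu> by (simp add: param_range_def)
    define g where "g = grad (Fs \<mu>) y"
    have "norm g \<le> K + \<kappa> + w1 + w2"
    proof (cases "g = 0")
      case True
      then show ?thesis using w \<kappa> lipschitz_on_nonneg[OF K] by simp
    next
      case False
      define d where "d = sgn g"
      have d: "norm d = 1" "d \<bullet> g = norm g" using False
        by (auto simp: d_def norm_sgn sgn_div_norm dot_square_norm power2_eq_square)
      define f where "f t = real_of_ereal (Fs \<mu> (y + t *\<^sub>R d))" for t
      have ball: "y + t *\<^sub>R d \<in> ball x \<rho>" if "0 \<le> t" "t \<le> \<mu>" for t
      proof -
        have "dist x (y + t *\<^sub>R d) \<le> dist x y + dist y (y + t *\<^sub>R d)" by (rule dist_triangle)
        also have "dist y (y + t *\<^sub>R d) \<le> r" using that d \<mu> by (simp add: dist_norm)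
        also have "dist x y + r < \<rho>" using y r by simp
        finally show ?thesis by simp
      qed
      have der: "(f has_real_derivative d \<bullet> grad (Fs \<mu>) (y + t *\<^sub>R d)) (at t)"
        if "0 \<le> t" "t \<le> \<mu>" for t
      proof -
        have "y + t *\<^sub>R d \<in> interior (edom F)" using ball[OF that] \<rho> by blast
        note G = smoothing_function_GDERIV[OF sm \<mu>(1) this, unfolded gderiv_def]
        have "((\<lambda>t. y + t *\<^sub>R d) has_derivative (\<lambda>h. h *\<^sub>R d)) (at t)"
          by (auto intro!: derivative_eq_intros)
        from has_derivative_compose[OF this G]
        have "(f has_derivative (\<lambda>h. (h *\<^sub>R d) \<bullet> grad (Fs \<mu>) (y + t *\<^sub>R d))) (at t)"
          by (simp add: f_def[abs_def])
        then show ?thesis by (rule has_derivative_imp_has_field_derivative) simp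
      qed
      obtain \<xi> where \<xi>: "0 < \<xi>" "\<xi> < \<mu>"
        "f \<mu> - f 0 = (\<mu> - 0) * (d \<bullet> grad (Fs \<mu>) (y + \<xi> *\<^sub>R d))"
        using MVT2[OF \<mu>0 der] by blast
      define D where "D = grad (Fs \<mu>) (y + \<xi> *\<^sub>R d) - g"
      have yin: "y \<in> U \<inter> interior (edom F)" and \<xi>in: "y + \<xi> *\<^sub>R d \<in> interior (edom F)"
        and \<mu>in: "y + \<mu> *\<^sub>R d \<in> U \<inter> interior (edom F)"
        using ball[of 0] ball[of \<xi>] ball[of \<mu>] \<rho>(2) \<xi> \<mu>0 by auto
      have "norm D \<le> (w1 + w2 * inverse \<mu>) * dist (y + \<xi> *\<^sub>R d) y"
        unfolding D_def g_def using lipschitz_onD[OF L[OF \<mu>(1)] \<xi>in, of y] yin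
        by (simp add: dist_norm)
      also have "\<dots> \<le> (w1 + w2 * inverse \<mu>) * \<mu>"
        using \<xi> w \<mu>0 d by (intro mult_left_mono) (auto simp: dist_norm)
      also have "\<dots> = w1 * \<mu> + w2" using \<mu>0 by (simp add: field_simps)
      also have "w1 * \<mu> \<le> w1" using w \<mu> r by (intro mult_left_le) auto
      finally have "norm D \<le> w1 + w2" by simp
      moreover have "\<bar>d \<bullet> D\<bar> \<le> norm D" using Cauchy_Schwarz_ineq2[of d D] d by simp
      ultimately have "norm g - (w1 + w2) \<le> d \<bullet> grad (Fs \<mu>) (y + \<xi> *\<^sub>R d)"
        using d by (simp add: D_def inner_diff_right)
      then have "\<mu> * (norm g - (w1 + w2)) \<le> f \<mu> - f 0" using \<xi>(3) \<mu>0 by simp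
      also have "\<dots> \<le> K * \<mu> + \<kappa> * \<mu>"
      proof -
        \<comment> \<open>\<open>Fs \<mu>\<close> lies below \<open>F\<close>, so the smoothing
          error is paid only at the starting point \<open>y\<close>.\<close>
        obtain a b where ab: "F y = ereal a" "Fs \<mu> y = ereal b" "a \<le> b + \<kappa> * \<mu>"
          using gap[OF \<mu>(1), of y] yin by blast
        obtain a' b' where ab': "F (y + \<mu> *\<^sub>R d) = ereal a'" "Fs \<mu> (y + \<mu> *\<^sub>R d) = ereal b'" "b' \<le> a'"
          using gap[OF \<mu>(1), of "y + \<mu> *\<^sub>R d"] \<mu>in by blast
        have "\<bar>a' - a\<bar> \<le> K * dist (y + \<mu> *\<^sub>R d) y"
          using lipschitz_onD[OF K, of "y + \<mu> *\<^sub>R d" y] yin \<mu>in ab ab' by (simp add: dist_real_def)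
        also have "\<dots> = K * \<mu>" using d \<mu>0 by (simp add: dist_norm)
        finally show ?thesis using ab ab' by (simp add: f_def)
      qed
      finally have "\<mu> * (norm g - (w1 + w2)) \<le> \<mu> * (K + \<kappa>)" by (simp add: algebra_simps)
      then show ?thesis using \<mu>0 by simp
    qed
    then show "norm (grad (Fs \<mu>) y) \<le> K + \<kappa> + w1 + w2" by (simp add: g_def)
  qed
qed

text \<open>A penalised minimiser \<open>y\<close> over a small closed ball is interior once
  \<open>\<mu>\<close> is small, and Fermat's rule then gives \<open>w\<close>. The bound on
  \<open>\<phi> y\<close> is recorded because limiting subgradients require convergence of function
  values.\<close>

lemma perturbed_stationarity:
  fixes F \<phi> :: "'a::euclidean_space \<Rightarrow> ereal"
  assumes sm: "smoothing_function F \<mu>t Fs" and "0 < \<mu>t"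
    and \<phi>: "no_minus_infinity \<phi>" "lower_semicontinuous \<phi>"
    and lip: "locally_lipschitz_at F x" and x: "x \<in> interior (edom F)" "x \<in> edom \<phi>"
    and F: "no_minus_infinity F"
    and stat: "0 \<in> frechet_subdiff (\<lambda>y. F y + \<phi> y) x" and \<epsilon>: "\<epsilon> > 0"
  shows "\<forall>\<^sub>F \<mu> in at_right 0. \<mu> \<in> param_range \<mu>t \<and>
    (\<exists>y w. y \<in> interior (edom F) \<and> dist y x \<le> \<epsilon> \<and> \<phi> y \<le> \<phi> x + ereal \<epsilon> \<and>
       w \<in> frechet_subdiff \<phi> y \<and> norm (w + grad (Fs \<mu>) y) \<le> \<epsilon>)"
proof -
  obtain \<kappa> where \<kappa>: "\<kappa> > 0" and gap: "\<And>\<mu> x. \<lbrakk>\<mu> \<in> param_range \<mu>t; x \<in> interior (edom F)\<rbrakk> \<Longrightarrow>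
    \<exists>a b. F x = ereal a \<and> Fs \<mu> x = ereal b \<and> b \<le> a \<and> a \<le> b + \<kappa> * \<mu>"
    using smoothing_function_gap[OF sm] by blast
  have "x \<in> edom F" using x interior_subset by blast
  obtain a where a: "F x = ereal a" using edom_finiteE[OF F \<open>x \<in> edom F\<close>] .
  obtain b where b: "\<phi> x = ereal b" using edom_finiteE[OF \<phi>(1) x(2)] .
  obtain U K where U: "open U" "x \<in> U" and K: "lipschitz_on K U (\<lambda>y. real_of_ereal (F y))"
    using lip unfolding locally_lipschitz_at_def by blast
  have K0: "K \<ge> 0" using lipschitz_on_nonneg[OF K] .
  have "\<forall>\<^sub>F y in nhds x. ereal (a + b + 0 \<bullet> (y - x) - \<epsilon> / 4 * norm (y - x)) \<le> F y + \<phi> y"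
  proof -
    have "F x + \<phi> x = ereal (a + b)" using a b by simp
    from frechet_subdiff_iff[of "\<lambda>y. F y + \<phi> y", OF this, THEN iffD1, OF stat, rule_format, of "\<epsilon> / 4"]
    show ?thesis using \<epsilon> by simp
  qed
  moreover have "\<forall>\<^sub>F y in nhds x. y \<in> U \<inter> interior (edom F)"
    using U x by (intro eventually_nhds_in_open) auto
  ultimately have "\<forall>\<^sub>F y in nhds x. y \<in> U \<inter> interior (edom F) \<and>
      ereal (a + b - \<epsilon> / 4 * norm (y - x)) \<le> F y + \<phi> y"
    by eventually_elim simp
  then obtain \<rho> where \<rho>: "\<rho> > 0" "\<And>y. dist y x < \<rho> \<Longrightarrow> y \<in> U \<inter> interior (edom F) \<and>
      ereal (a + b - \<epsilon> / 4 * norm (y - x)) \<le> F y + \<phi> y"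
    unfolding eventually_nhds_metric by blast
  \<comment> \<open>The three bounds keep the closed ball where the Frechet estimate holds, keep
    \<open>y\<close> within \<open>\<epsilon>\<close> of \<open>x\<close>, and give
    \<open>K * r \<le> \<epsilon> / 2\<close>.\<close>
  define r where "r = min (\<rho> / 2) (min \<epsilon> (\<epsilon> / (2 * (K + 1))))"
  have "r \<le> \<rho> / 2" unfolding r_def by (rule min.cobounded1)
  moreover have "r > 0" "r \<le> \<epsilon>" using \<rho>(1) \<epsilon> K0 by (simp_all add: r_def)
  ultimately have r: "r > 0" "r < \<rho>" "r \<le> \<epsilon>" using \<rho>(1) by auto
  have "r \<le> \<epsilon> / (2 * (K + 1))" by (simp add: r_def)
  then have "r * (2 * (K + 1)) \<le> \<epsilon>" using K0 by (simp add: pos_le_divide_eq)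
  then have Kr: "K * r \<le> \<epsilon> / 2" using r(1) by (simp add: algebra_simps)
  have ball: "y \<in> U" "y \<in> interior (edom F)"
      "ereal (a + b - \<epsilon> / 4 * norm (y - x)) \<le> F y + \<phi> y" if "y \<in> cball x r" for y
    using \<rho>(2)[of y] that r by (auto simp: dist_commute)
  \<comment> \<open>The first bound on \<open>\<kappa> * \<mu>\<close> keeps the minimiser off the
    sphere; the second controls the value of \<open>\<phi>\<close> there.\<close>
  have step: "\<exists>y w. y \<in> interior (edom F) \<and> dist y x \<le> \<epsilon> \<and> \<phi> y \<le> \<phi> x + ereal \<epsilon> \<and>
       w \<in> frechet_subdiff \<phi> y \<and> norm (w + grad (Fs \<mu>) y) \<le> \<epsilon>"
    if \<mu>: "\<mu> \<in> param_range \<mu>t" "\<kappa> * \<mu> < \<epsilon> * r / 4" "\<kappa> * \<mu> \<le> \<epsilon> / 2" for \<mu>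
  proof -
    \<comment> \<open>The coefficient \<open>\<epsilon> / r\<close> makes the penalty gradient at
      most \<open>\<epsilon>\<close> in norm on the ball of radius \<open>r\<close>, while the
      penalty itself reaches \<open>\<epsilon> * r / 2\<close> on the sphere.\<close>
    define f where "f y = real_of_ereal (Fs \<mu> y) + (\<epsilon> / r) / 2 * (norm (y - x))\<^sup>2" for y
    have G: "GDERIV f y :> grad (Fs \<mu>) y + (\<epsilon> / r) *\<^sub>R (y - x)" if "y \<in> cball x r" for y
      unfolding f_def
      by (intro GDERIV_add smoothing_function_GDERIV[OF sm \<mu>(1)] ball that GDERIV_scaled_norm_square)
    have "continuous_on (cball x r) f"
      using G unfolding gderiv_def
      by (meson continuous_at_imp_continuous_on has_derivative_continuous)
    then obtain y where y: "y \<in> cball x r"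
      and min: "\<And>z. z \<in> cball x r \<Longrightarrow> \<phi> y + ereal (f y) \<le> \<phi> z + ereal (f z)"
      using lower_semicontinuous_plus_continuous_attains_inf[OF _ _ \<phi>, of "cball x r" f] r(1)
      by (auto simp: less_imp_le)
    obtain Fy fy where Fy: "F y = ereal Fy" "Fs \<mu> y = ereal fy" "Fy \<le> fy + \<kappa> * \<mu>"
      using gap[OF \<mu>(1) ball(2)[OF y]] by blast
    obtain fx where fx: "Fs \<mu> x = ereal fx" "fx \<le> a"
      using gap[OF \<mu>(1) x(1)] a by auto
    have minx: "\<phi> y + ereal (f y) \<le> ereal (b + f x)" using min[of x] r(1) b by simp
    then obtain c where c: "\<phi> y = ereal c"
      using \<phi>(1) by (cases "\<phi> y") (auto simp: no_minus_infinity_def)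
    have *: "c + fy + (\<epsilon> / r) / 2 * (norm (y - x))\<^sup>2 \<le> b + a"
      using minx c Fy fx by (simp add: f_def)
    have fr: "a + b - \<epsilon> / 4 * norm (y - x) \<le> Fy + c" using ball(3)[OF y] Fy c by simp
    have ny: "norm (y - x) \<le> r" using y by (simp add: dist_norm norm_minus_commute)
    \<comment> \<open>On the sphere the penalty \<open>\<epsilon> * r / 2\<close> beats the Frechet error \<open>\<epsilon> * r / 4\<close> plus the smoothing gap.\<close>
    have "norm (y - x) \<noteq> r"
    proof
      assume "norm (y - x) = r"
      then have "(\<epsilon> / r) / 2 * (norm (y - x))\<^sup>2 = \<epsilon> * r / 2"
        using r(1) by (simp add: power2_eq_square)
      then show False using * fr \<mu>(2) Fy(3) \<open>norm (y - x) = r\<close> by simp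
    qed
    then have "y \<in> ball x r" using ny by (simp add: dist_norm norm_minus_commute)
    then have "\<forall>\<^sub>F z in nhds y. z \<in> ball x r" by (intro eventually_nhds_in_open) auto
    then have "\<forall>\<^sub>F z in nhds y. \<phi> y + ereal (f y) \<le> \<phi> z + ereal (f z)"
      by eventually_elim (auto intro: min)
    from fermat_rule[where \<phi> = \<phi>, OF c this G[OF y]]
    have w: "- (grad (Fs \<mu>) y + (\<epsilon> / r) *\<^sub>R (y - x)) \<in> frechet_subdiff \<phi> y" .
    \<comment> \<open>The change of \<open>F\<close> costs at most \<open>K * r\<close>, hence
      \<open>\<epsilon> / 2\<close>; the smoothing gap takes the other half of the allowance for
      \<open>\<phi> y\<close>.\<close>
    have "\<bar>a - Fy\<bar> \<le> K * dist x y"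
      using lipschitz_onD[OF K U(2) ball(1)[OF y]] a Fy by (simp add: dist_real_def)
    also have "\<dots> \<le> K * r" using y K0 by (intro mult_left_mono) auto
    finally have "\<bar>a - Fy\<bar> \<le> K * r" .
    moreover have "0 \<le> (\<epsilon> / r) / 2 * (norm (y - x))\<^sup>2" using \<epsilon> r(1) by simp
    ultimately have "c \<le> b + \<epsilon>" using * Fy(3) \<mu>(3) Kr by linarith
    moreover have "norm ((\<epsilon> / r) *\<^sub>R (y - x)) \<le> \<epsilon>"
      using ny r(1) \<epsilon> by (simp add: pos_divide_le_eq)
    moreover have "dist y x \<le> \<epsilon>" using ny r(3) by (simp add: dist_norm)
    ultimately show ?thesis
      using w ball(2)[OF y] b c
      by (intro exI[of _ y] exI[of _ "- (grad (Fs \<mu>) y + (\<epsilon> / r) *\<^sub>R (y - x))"]) auto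
  qed
  obtain \<mu>1 where \<mu>1: "\<mu>1 > 0" "ereal \<mu>1 < \<mu>t" using ereal_dense2[OF \<open>0 < \<mu>t\<close>] by (auto simp: zero_ereal_def)
  define \<mu>2 where "\<mu>2 = min \<mu>1 (min (\<epsilon> * r / 4 / \<kappa>) (\<epsilon> / 2 / \<kappa>))"
  have \<mu>2: "\<mu>2 > 0" using \<mu>1 \<epsilon> r \<kappa> by (simp add: \<mu>2_def)
  have "\<forall>\<^sub>F \<mu> in at_right 0. \<mu> \<in> {0<..<\<mu>2}" using eventually_at_right_real[OF \<mu>2] .
  then show ?thesis
  proof eventually_elim
    case (elim \<mu>)
    have "ereal \<mu> < \<mu>t" using elim \<mu>1(2) less_trans[of "ereal \<mu>" "ereal \<mu>1" \<mu>t] by (simp add: \<mu>2_def)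
    then have "\<mu> \<in> param_range \<mu>t" using elim by (simp add: param_range_def)
    moreover have "\<mu> < \<epsilon> * r / 4 / \<kappa>" "\<mu> < \<epsilon> / 2 / \<kappa>" using elim by (auto simp: \<mu>2_def)
    then have "\<kappa> * \<mu> < \<epsilon> * r / 4" "\<kappa> * \<mu> \<le> \<epsilon> / 2"
      using \<kappa> by (auto simp: pos_less_divide_eq mult_ac)
    ultimately show ?case using step by blast
  qed
qed

text \<open>Running minima of the thresholds give monotonicity, and division by a growing factor
  gives the limit 0. The predicates for different \<open>k\<close> may be unrelated.\<close>

lemma eventually_at_right_decreasing_sequence:
  assumes "\<And>k. \<forall>\<^sub>F \<mu> in at_right (0::real). P k \<mu>"
  shows "\<exists>\<mu>s. decreases_to_zero \<mu>s \<and> (\<forall>k::nat. P k (\<mu>s k))"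
proof -
  have "\<forall>k. \<exists>b>0. \<forall>\<mu>>0. \<mu> < b \<longrightarrow> P k \<mu>"
    using assms by (simp add: eventually_at_right_field)
  from choice[OF this] obtain t where t: "\<And>k. t k > 0" "\<And>k \<mu>. \<lbrakk>0 < \<mu>; \<mu> < t k\<rbrakk> \<Longrightarrow> P k \<mu>"
    by blast
  define m where "m k = Min (t ` {..k})" for k
  \<comment> \<open>\<open>real k + 2\<close> exceeds 1 already at \<open>k = 0\<close>, so
    \<open>\<mu>s k\<close> is strictly below the threshold \<open>m k\<close>.\<close>
  define \<mu>s where "\<mu>s k = m k / (real k + 2)" for k
  have m: "m k > 0" "m k \<le> t k" "m k \<le> t 0" for k
    using t(1) by (auto simp: m_def)
  have mdec: "m k \<le> m j" if "j \<le> k" for j k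
    unfolding m_def by (rule Min_antimono) (use that in auto)
  have pos: "\<mu>s k > 0" for k using m(1)[of k] by (simp add: \<mu>s_def)
  show ?thesis
  proof (intro exI conjI allI)
    have "\<mu>s k \<le> \<mu>s j" if "j \<le> k" for j k
      unfolding \<mu>s_def using that mdec[OF that] m(1)[of k] by (intro frac_le) auto
    then have "decseq \<mu>s" by (simp add: decseq_def)
    moreover have "\<mu>s \<longlonglongrightarrow> 0"
    proof (rule real_tendsto_sandwich)
      show "\<forall>\<^sub>F k in sequentially. 0 \<le> \<mu>s k" using pos by (simp add: less_imp_le)
      show "\<forall>\<^sub>F k in sequentially. \<mu>s k \<le> t 0 / real (Suc k)"
        unfolding \<mu>s_def using m(1,3) t(1)[of 0] by (intro always_eventually allI frac_le) (auto simp: less_imp_le)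
      show "(\<lambda>k. t 0 / real (Suc k)) \<longlonglongrightarrow> 0" by (rule LIMSEQ_Suc[OF lim_const_over_n])
    qed simp
    ultimately show "decreases_to_zero \<mu>s" by (simp add: decreases_to_zero_def)
    show "P k (\<mu>s k)" for k
    proof (rule t(2)[OF pos])
      have "\<mu>s k < m k" using m(1)[of k] by (simp add: \<mu>s_def divide_less_eq algebra_simps add_pos_nonneg)
      then show "\<mu>s k < t k" using m(2)[of k] by simp
    qed
  qed
qed

section \<open>Smoothing gradients along sequences\<close>

lemma limiting_subdiff_smoothing:
  fixes F :: "'a::euclidean_space \<Rightarrow> ereal"
  assumes sm: "smoothing_function F \<mu>t Fs" and \<mu>: "\<mu> \<in> param_range \<mu>t" and x: "x \<in> interior (edom F)"
  shows "limiting_subdiff (Fs \<mu>) x = {grad (Fs \<mu>) x}"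
proof (rule limiting_subdiff_continuously_differentiable)
  show "continuously_differentiable_over (Fs \<mu>) (interior (edom F))"
    using sm \<mu> unfolding smoothing_function_def by blast
  show "\<bar>Fs \<mu> y\<bar> \<noteq> \<infinity>" if "y \<in> interior (edom F)" for y
    by (rule smoothing_function_gap[OF sm]) (use \<mu> that in fastforce)
qed (use x in auto)

lemma smoothing_function_limit_in_subdiff:
  fixes F :: "'a::euclidean_space \<Rightarrow> ereal"
  assumes sm: "smoothing_function F \<mu>t Fs" and x: "x \<in> interior (edom F)"
    and "\<And>n. xs n \<in> interior (edom F)" "\<And>n. \<mu>s n \<in> param_range \<mu>t" "xs \<longlonglongrightarrow> x"
      "decreases_to_zero \<mu>s" "(\<lambda>n. grad (Fs (\<mu>s n)) (xs n)) \<longlonglongrightarrow> v"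
  shows "v \<in> limiting_subdiff F x"
proof -
  have "limiting_subdiff F x =
          {v. \<exists>xs \<mu>s. (\<forall>n. xs n \<in> interior (edom F)) \<and> (\<forall>n. \<mu>s n \<in> param_range \<mu>t) \<and>
                      xs \<longlonglongrightarrow> x \<and> decreases_to_zero \<mu>s \<and>
                      (\<lambda>n. grad (Fs (\<mu>s n)) (xs n)) \<longlonglongrightarrow> v}"
    using sm x unfolding smoothing_function_def by blast
  then show ?thesis using assms(3-) by auto
qed

lemma decreases_to_zero_subseq:
  assumes "decreases_to_zero \<mu>s" "strict_mono r"
  shows "decreases_to_zero (\<lambda>n. \<mu>s (r n))"
  using assms LIMSEQ_subseq_LIMSEQ[of \<mu>s 0 r] strict_mono_mono[OF assms(2)]
  by (auto simp: decreases_to_zero_def decseq_def mono_def o_def)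

text \<open>The local gradient bound is uniform in both the point and the parameter, so it applies
  as soon as \<open>xs n\<close> and \<open>\<mu>s n\<close> are in range. It is the source of
  compactness for extracting convergent gradients.\<close>

lemma smoothing_gradients_eventually_bounded:
  fixes F :: "'a::euclidean_space \<Rightarrow> ereal"
  assumes sm: "smoothing_function F \<mu>t Fs" and lip: "locally_lipschitz_at F x"
    and x: "x \<in> interior (edom F)" and xs: "xs \<longlonglongrightarrow> x"
    and \<mu>s: "\<And>n. \<mu>s n \<in> param_range \<mu>t" "decreases_to_zero \<mu>s"
  obtains M where "\<forall>\<^sub>F n in sequentially. norm (grad (Fs (\<mu>s n)) (xs n)) \<le> M"
proof -
  obtain r M where r: "r > 0"
    "\<And>y \<mu>. \<lbrakk>y \<in> ball x r; \<mu> \<in> param_range \<mu>t; \<mu> \<le> r\<rbrakk> \<Longrightarrow> norm (grad (Fs \<mu>) y) \<le> M"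
    using smoothing_gradient_bounded[OF sm lip x] by blast
  have "\<forall>\<^sub>F n in sequentially. xs n \<in> ball x r"
    using topological_tendstoD[OF xs, of "ball x r"] r(1) by simp
  moreover have "\<forall>\<^sub>F n in sequentially. \<mu>s n < r"
    using \<mu>s(2) r(1) order_tendstoD(2) unfolding decreases_to_zero_def by blast
  ultimately have "\<forall>\<^sub>F n in sequentially. norm (grad (Fs (\<mu>s n)) (xs n)) \<le> M"
    by eventually_elim (use r(2) \<mu>s(1) in auto)
  then show thesis by (rule that)
qed

subsection \<open>Stationarity\<close>

text \<open>Frechet subgradients can be added, but passing to the limit only delivers limiting ones.
  Lower regularity of \<open>F\<close> and prox-regularity of \<open>\<phi>\<close> convert them,
  and the two opposite vectors sum to 0.\<close>

lemma frechet_stationary_if_limiting_inclusion: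
  fixes F \<phi> :: "'a::euclidean_space \<Rightarrow> ereal"
  assumes "no_minus_infinity F" "no_minus_infinity \<phi>" and x: "x \<in> edom \<phi>"
    and lr: "lower_regular_at F x" and pr: "prox_regular_at \<phi> x"
    and v: "v \<in> limiting_subdiff F x" "- v \<in> limiting_subdiff \<phi> x"
  shows "frechet_stationary F \<phi> x"
proof -
  have "x \<in> edom F" using lr by (simp add: lower_regular_at_def)
  with assms(1) obtain a where a: "F x = ereal a" by (rule edom_finiteE)
  from assms(2) x obtain b where b: "\<phi> x = ereal b" by (rule edom_finiteE)
  have "v \<in> frechet_subdiff F x" using lr v by (simp add: lower_regular_at_def)
  moreover have "- v \<in> frechet_subdiff \<phi> x"
    using prox_regular_limiting_subset_frechet[OF pr b] v by blast
  ultimately have "v + - v \<in> frechet_subdiff (\<lambda>y. F y + \<phi> y) x"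
    by (rule frechet_subdiff_add[of F x a \<phi> b, OF a b])
  then show ?thesis using x by (simp add: frechet_stationary_def)
qed

section \<open>The stationarity measure and the limiting inclusion\<close>

lemma stationarity_measure_nonneg: "0 \<le> stationarity_measure \<gamma> G \<phi> x"
  unfolding stationarity_measure_def by (rule Inf_greatest) auto

lemma stationarity_measure_lessE:
  assumes "stationarity_measure \<gamma> G \<phi> x < c"
  obtains p v where "p \<in> prox \<gamma> \<phi> (x - \<gamma> *\<^sub>R v)" "v \<in> limiting_subdiff G x"
    "ereal (norm ((x - p) /\<^sub>R \<gamma>)) < c"
  using assms unfolding stationarity_measure_def Inf_less_iff by blast

text \<open>Along a subsequence the residuals \<open>e\<close> vanish, so
  \<open>e n - g (q n)\<close> are subgradients of \<open>\<phi>\<close> at points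
  \<open>p n\<close> tending to \<open>x\<close>. Outer semicontinuity carries their limit over to
  \<open>x\<close> from convergence of the points alone; the values \<open>\<phi> (p n)\<close> are
  not controlled here.\<close>

lemma limiting_inclusion_if_measure_vanishes:
  fixes F \<phi> :: "'a::euclidean_space \<Rightarrow> ereal"
  assumes sm: "smoothing_function F \<mu>t Fs" and \<phi>: "no_minus_infinity \<phi>" "x \<in> edom \<phi>"
    and lip: "locally_lipschitz_at F x" and x: "x \<in> interior (edom F)"
    and osc: "outer_semicontinuous_at (limiting_subdiff \<phi>) x"
    and xs: "\<And>n. xs n \<in> interior (edom F)" "xs \<longlonglongrightarrow> x"
    and \<mu>s: "\<And>n. \<mu>s n \<in> param_range \<mu>t" "decreases_to_zero \<mu>s"
    and \<gamma>s: "\<And>n. 0 < \<gamma>s n" "\<And>n. \<gamma>s n \<le> \<gamma>t"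
    and lim: "liminf (\<lambda>n. stationarity_measure (\<gamma>s n) (Fs (\<mu>s n)) \<phi> (xs n)) = 0"
  obtains v where "v \<in> limiting_subdiff F x" "- v \<in> limiting_subdiff \<phi> x"
proof -
  define M where "M n = stationarity_measure (\<gamma>s n) (Fs (\<mu>s n)) \<phi> (xs n)" for n
  define g where "g n = grad (Fs (\<mu>s n)) (xs n)" for n
  obtain r where r: "strict_mono r" "(M \<circ> r) \<longlonglongrightarrow> 0"
    using liminf_subseq_lim[of M] lim unfolding M_def[abs_def] by auto
  obtain B where "\<forall>\<^sub>F n in sequentially. norm (g n) \<le> B"
    unfolding g_def by (rule smoothing_gradients_eventually_bounded[OF sm lip x xs(2) \<mu>s])
  then have "\<forall>\<^sub>F n in sequentially. norm (g (r n)) \<le> B"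
    using filterlim_subseq[OF r(1)] by (rule eventually_compose_filterlim)
  moreover have "\<forall>\<^sub>F n in sequentially. (M \<circ> r) n < 1"
    by (rule order_tendstoD(2)[OF r(2)]) simp
  ultimately have "\<forall>\<^sub>F n in sequentially. norm (g (r n)) \<le> B \<and> M (r n) < 1"
    by eventually_elim simp
  then obtain N where N: "\<And>n. n \<ge> N \<Longrightarrow> norm (g (r n)) \<le> B \<and> M (r n) < 1"
    unfolding eventually_sequentially by blast
  \<comment> \<open>Dropping \<open>N\<close> terms makes both bounds hold at every index, so the
    measure is finite throughout.\<close>
  define s where "s n = r (n + N)" for n
  have s: "strict_mono s" using r(1) by (simp add: s_def strict_mono_def)
  have "(\<lambda>n. g (s n)) ` UNIV \<subseteq> cball 0 B" using N by (auto simp: s_def)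
  then have "bounded (range (\<lambda>n. g (s n)))" using bounded_cball bounded_subset by blast
  then obtain v t where t: "strict_mono t" "((\<lambda>n. g (s n)) \<circ> t) \<longlonglongrightarrow> v"
    using bounded_imp_convergent_subsequence by blast
  define q where "q n = s (t n)" for n
  have q: "strict_mono q" using strict_mono_o[OF s t(1)] by (simp add: q_def[abs_def] o_def)
  have gq: "(\<lambda>n. g (q n)) \<longlonglongrightarrow> v" using t(2) by (simp add: q_def o_def)
  have xq: "(\<lambda>n. xs (q n)) \<longlonglongrightarrow> x"
    using LIMSEQ_subseq_LIMSEQ[OF xs(2) q] by (simp add: o_def)
  have "((M \<circ> r) \<circ> (\<lambda>n. t n + N)) \<longlonglongrightarrow> 0"
    using t(1) by (intro LIMSEQ_subseq_LIMSEQ[OF r(2)]) (simp add: strict_mono_def)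
  then have Mq: "(\<lambda>n. M (q n)) \<longlonglongrightarrow> 0" by (simp add: q_def s_def o_def)
  have M1: "M (q n) < 1" for n using N[of "t n + N"] by (simp add: q_def s_def)
  define m where "m n = real_of_ereal (M (q n))" for n
  have Mm: "M (q n) = ereal (m n)" for n
    using M1[of n] stationarity_measure_nonneg[of "\<gamma>s (q n)" "Fs (\<mu>s (q n))" \<phi> "xs (q n)"]
    by (cases "M (q n)") (auto simp: m_def M_def)
  have m0: "m \<longlonglongrightarrow> 0" using Mq unfolding Mm zero_ereal_def by (simp add: zero_ereal_def)
  \<comment> \<open>The infimum in the measure may fail to be attained; exceeding it by
    \<open>1 / (n + 1)\<close> leaves room for an actual proximal point.\<close>
  define c where "c n = m n + inverse (real (Suc n))" for n
  have c0: "c \<longlonglongrightarrow> 0"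
    unfolding c_def using tendsto_add[OF m0 LIMSEQ_inverse_real_of_nat] by simp
  have "\<exists>p. p \<in> prox (\<gamma>s (q n)) \<phi> (xs (q n) - \<gamma>s (q n) *\<^sub>R g (q n)) \<and>
      norm ((xs (q n) - p) /\<^sub>R \<gamma>s (q n)) < c n" for n
  proof -
    have "stationarity_measure (\<gamma>s (q n)) (Fs (\<mu>s (q n))) \<phi> (xs (q n)) < ereal (c n)"
      using Mm[of n] by (simp add: M_def c_def)
    then show ?thesis
    proof (rule stationarity_measure_lessE)
      fix p w assume "p \<in> prox (\<gamma>s (q n)) \<phi> (xs (q n) - \<gamma>s (q n) *\<^sub>R w)"
        "w \<in> limiting_subdiff (Fs (\<mu>s (q n))) (xs (q n))"
        "ereal (norm ((xs (q n) - p) /\<^sub>R \<gamma>s (q n))) < ereal (c n)"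
      then show ?thesis
        using limiting_subdiff_smoothing[OF sm \<mu>s(1) xs(1)] by (auto simp: g_def)
    qed
  qed
  then obtain p where p: "\<And>n. p n \<in> prox (\<gamma>s (q n)) \<phi> (xs (q n) - \<gamma>s (q n) *\<^sub>R g (q n))"
    and pc: "\<And>n. norm ((xs (q n) - p n) /\<^sub>R \<gamma>s (q n)) < c n" by metis
  define e where "e n = (xs (q n) - p n) /\<^sub>R \<gamma>s (q n)" for n
  have e0: "e \<longlonglongrightarrow> 0"
    by (rule Lim_null_comparison[OF _ c0]) (use pc in \<open>auto simp: e_def less_imp_le\<close>)
  \<comment> \<open>The upper bound \<open>\<gamma>t\<close> on the parameters turns a vanishing
    residual into a vanishing distance between \<open>xs (q n)\<close> and
    \<open>p n\<close>.\<close>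
  have "(\<lambda>n. \<gamma>s (q n) *\<^sub>R e n) \<longlonglongrightarrow> 0"
  proof (rule Lim_null_comparison)
    show "\<forall>\<^sub>F n in sequentially. norm (\<gamma>s (q n) *\<^sub>R e n) \<le> \<gamma>t * norm (e n)"
      using \<gamma>s by (auto intro!: always_eventually mult_right_mono simp: less_imp_le abs_of_pos)
    show "(\<lambda>n. \<gamma>t * norm (e n)) \<longlonglongrightarrow> 0"
      using tendsto_mult_right_zero[OF tendsto_norm_zero[OF e0], of \<gamma>t] .
  qed
  from tendsto_diff[OF xq this] have "(\<lambda>n. xs (q n) - \<gamma>s (q n) *\<^sub>R e n) \<longlonglongrightarrow> x" by simp
  moreover have "xs (q n) - \<gamma>s (q n) *\<^sub>R e n = p n" for n
    using \<gamma>s(1)[of "q n"] by (simp add: e_def)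
  ultimately have p0: "p \<longlonglongrightarrow> x" by simp
  have sub: "e n - g (q n) \<in> limiting_subdiff \<phi> (p n)" for n
  proof -
    have "p n \<in> edom \<phi>" by (rule prox_in_edom[OF p \<phi>(2)])
    with \<phi>(1) obtain b where "\<phi> (p n) = ereal b" by (rule edom_finiteE)
    from prox_fermat_rule[OF p \<gamma>s(1) this] show ?thesis
      using frechet_subset_limiting_subdiff by (auto simp: e_def)
  qed
  have "(\<lambda>n. e n - g (q n)) \<longlonglongrightarrow> - v" using tendsto_diff[OF e0 gq] by simp
  then have "- v \<in> outer_limit (\<lambda>n. limiting_subdiff \<phi> (p n))"
    unfolding outer_limit_def using sub strict_mono_id
    by (intro CollectI exI[of _ id] exI[of _ "\<lambda>n. e n - g (q n)"]) auto
  then have "- v \<in> limiting_subdiff \<phi> x"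
    using osc p0 unfolding outer_semicontinuous_at_def by blast
  moreover have "v \<in> limiting_subdiff F x"
    by (rule smoothing_function_limit_in_subdiff[OF sm x xs(1) \<mu>s(1) xq
          decreases_to_zero_subseq[OF \<mu>s(2) q] gq[unfolded g_def]])
  ultimately show thesis using that by blast
qed

text \<open>Prox-regularity is used at the limit subgradient \<open>- v\<close>, so its constants
  \<open>\<delta>\<close> and \<open>\<eta>\<close> are fixed before \<open>\<gamma>\<close> is
  chosen. Hence a single \<open>\<gamma>\<close> serves the entire sequence.\<close>

lemma measure_vanishes_if_stationary:
  fixes F \<phi> :: "'a::euclidean_space \<Rightarrow> ereal"
  assumes sm: "smoothing_function F \<mu>t Fs" and \<mu>t: "0 < \<mu>t"
    and \<phi>: "no_minus_infinity \<phi>" "lower_semicontinuous \<phi>" "x \<in> edom \<phi>"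
    and F: "no_minus_infinity F" "locally_lipschitz_at F x" and x: "x \<in> interior (edom F)"
    and pb: "prox_bounded_with \<phi> \<gamma>\<phi>" and pr: "prox_regular_at \<phi> x"
    and \<gamma>t: "0 < \<gamma>t" "ereal \<gamma>t < \<gamma>\<phi>"
    and stat: "frechet_stationary F \<phi> x"
  shows "\<exists>xs \<mu>s \<gamma>. (\<forall>n. xs n \<in> interior (edom F)) \<and> xs \<longlonglongrightarrow> x \<and>
       (\<forall>n. \<mu>s n \<in> param_range \<mu>t) \<and> decreases_to_zero \<mu>s \<and> 0 < \<gamma> \<and> \<gamma> \<le> \<gamma>t \<and>
       (\<lambda>n. stationarity_measure \<gamma> (Fs (\<mu>s n)) \<phi> (xs n)) \<longlonglongrightarrow> 0"
proof -
  from \<phi>(1,3) obtain b where b: "\<phi> x = ereal b" by (rule edom_finiteE)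
  have stat': "0 \<in> frechet_subdiff (\<lambda>y. F y + \<phi> y) x" using stat by (simp add: frechet_stationary_def)
  define \<epsilon> where "\<epsilon> k = inverse (real (Suc k))" for k
  have \<epsilon>: "\<epsilon> k > 0" for k by (simp add: \<epsilon>_def)
  have \<epsilon>0: "\<epsilon> \<longlonglongrightarrow> 0" unfolding \<epsilon>_def by (rule LIMSEQ_inverse_real_of_nat)
  have "\<exists>\<mu>s. decreases_to_zero \<mu>s \<and> (\<forall>k. \<mu>s k \<in> param_range \<mu>t \<and>
    (\<exists>y w. y \<in> interior (edom F) \<and> dist y x \<le> \<epsilon> k \<and> \<phi> y \<le> \<phi> x + ereal (\<epsilon> k) \<and>
       w \<in> frechet_subdiff \<phi> y \<and> norm (w + grad (Fs (\<mu>s k)) y) \<le> \<epsilon> k))"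
    by (rule eventually_at_right_decreasing_sequence
      [OF perturbed_stationarity[OF sm \<mu>t \<phi>(1,2) F(2) x \<phi>(3) F(1) stat' \<epsilon>]])
  then obtain \<mu>s where \<mu>s: "decreases_to_zero \<mu>s" "\<And>k. \<mu>s k \<in> param_range \<mu>t"
    and ex: "\<forall>k. \<exists>y w. y \<in> interior (edom F) \<and> dist y x \<le> \<epsilon> k \<and> \<phi> y \<le> \<phi> x + ereal (\<epsilon> k) \<and>
       w \<in> frechet_subdiff \<phi> y \<and> norm (w + grad (Fs (\<mu>s k)) y) \<le> \<epsilon> k"
    by auto
  from ex obtain ys ws where ys: "\<And>k. ys k \<in> interior (edom F)" "\<And>k. dist (ys k) x \<le> \<epsilon> k"
      "\<And>k. \<phi> (ys k) \<le> \<phi> x + ereal (\<epsilon> k)"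
    and ws: "\<And>k. ws k \<in> frechet_subdiff \<phi> (ys k)"
      "\<And>k. norm (ws k + grad (Fs (\<mu>s k)) (ys k)) \<le> \<epsilon> k" by metis
  have y0: "ys \<longlonglongrightarrow> x"
    using Lim_null_comparison[OF _ \<epsilon>0, of "\<lambda>k. ys k - x"] ys(2)
    by (simp add: dist_norm LIM_zero_iff)
  define g where "g n = grad (Fs (\<mu>s n)) (ys n)" for n
  obtain B where "\<forall>\<^sub>F n in sequentially. norm (g n) \<le> B"
    unfolding g_def by (rule smoothing_gradients_eventually_bounded[OF sm F(2) x y0 \<mu>s(2,1)])
  then obtain N where N: "\<And>n. n \<ge> N \<Longrightarrow> norm (g n) \<le> B"
    unfolding eventually_sequentially by blast
  have "range (\<lambda>n. g (n + N)) \<subseteq> cball 0 B" using N by auto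
  then have "bounded (range (\<lambda>n. g (n + N)))" using bounded_cball bounded_subset by blast
  then obtain v t where t: "strict_mono t" "((\<lambda>n. g (n + N)) \<circ> t) \<longlonglongrightarrow> v"
    using bounded_imp_convergent_subsequence by blast
  define q where "q n = t n + N" for n
  have q: "strict_mono q" using t(1) by (simp add: q_def strict_mono_def)
  have gq: "(\<lambda>n. g (q n)) \<longlonglongrightarrow> v" using t(2) by (simp add: q_def o_def)
  have yq: "(\<lambda>n. ys (q n)) \<longlonglongrightarrow> x" using LIMSEQ_subseq_LIMSEQ[OF y0 q] by (simp add: o_def)
  have \<epsilon>q: "(\<lambda>n. \<epsilon> (q n)) \<longlonglongrightarrow> 0" using LIMSEQ_subseq_LIMSEQ[OF \<epsilon>0 q] by (simp add: o_def)
  define e where "e n = ws (q n) + g (q n)" for n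
  have en: "norm (e n) \<le> \<epsilon> (q n)" for n using ws(2) by (simp add: e_def g_def)
  have e0: "e \<longlonglongrightarrow> 0" by (rule Lim_null_comparison[OF _ \<epsilon>q]) (use en in auto)
  have wq: "(\<lambda>n. ws (q n)) \<longlonglongrightarrow> - v" using tendsto_diff[OF e0 gq] by (simp add: e_def)
  \<comment> \<open>Lower semicontinuity gives the lower half of this convergence of values; the
    upper half is the bound \<open>\<phi> x + ereal (\<epsilon> k)\<close> from the
    perturbation.\<close>
  have \<phi>q: "(\<lambda>n. \<phi> (ys (q n))) \<longlonglongrightarrow> \<phi> x"
  proof (rule order_tendstoI)
    fix a assume "a < \<phi> x"
    from lower_semicontinuous_eventually[OF \<phi>(2) this] yq
    show "\<forall>\<^sub>F n in sequentially. a < \<phi> (ys (q n))" by (rule eventually_compose_filterlim)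
  next
    fix a assume a: "\<phi> x < a"
    have "(\<lambda>n. ereal (b + \<epsilon> (q n))) \<longlonglongrightarrow> ereal (b + 0)"
      by (intro tendsto_intros \<epsilon>q)
    then have "\<forall>\<^sub>F n in sequentially. ereal (b + \<epsilon> (q n)) < a"
      by (rule order_tendstoD(2)) (use a b in simp)
    then show "\<forall>\<^sub>F n in sequentially. \<phi> (ys (q n)) < a"
      by eventually_elim (use ys(3) b in \<open>auto intro: le_less_trans\<close>)
  qed
  have "- v \<in> limiting_subdiff \<phi> x"
    unfolding limiting_subdiff_def using \<phi>(3) yq \<phi>q ws(1) wq
    by (intro CollectI conjI exI[of _ "\<lambda>n. ys (q n)"] exI[of _ "\<lambda>n. ws (q n)"]) auto
  then have "prox_regular_at_for \<phi> x (- v)" using pr by (simp add: prox_regular_at_def)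
  then obtain \<delta> \<eta> where \<delta>: "\<delta> > 0" "\<eta> \<ge> 0" and reg: "\<forall>y w.
        y \<in> ball x \<delta> \<and> w \<in> limiting_subdiff \<phi> y \<inter> ball (- v) \<delta> \<and> \<phi> y < \<phi> x + ereal \<delta> \<longrightarrow>
        (\<forall>y'\<in>ball x \<delta>. \<phi> y' \<ge> \<phi> y + ereal (w \<bullet> (y' - y) - \<eta> / 2 * (norm (y' - y))\<^sup>2))"
    unfolding prox_regular_at_for_def by blast
  obtain m where low: "\<And>x. ereal m \<le> \<phi> x + ereal (1 / (2 * \<gamma>t) * (norm x)\<^sup>2)"
    using pb \<gamma>t unfolding prox_bounded_with_def by blast
  \<comment> \<open>The margin 1 covers the points, gradients and values that are eventually within
    1 of their limits.\<close>
  define C where "C = max (norm x + 1) (max (norm v + 1) (b + 1))"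
  obtain \<gamma>0 where \<gamma>0: "\<gamma>0 > 0" and near: "\<And>\<gamma> y w p. \<lbrakk>0 < \<gamma>; \<gamma> \<le> \<gamma>0; norm y \<le> C; norm w \<le> C;
      \<phi> y \<le> ereal C; p \<in> prox \<gamma> \<phi> (y - \<gamma> *\<^sub>R w)\<rbrakk> \<Longrightarrow> norm (p - y) < \<delta> / 2"
    using prox_near[OF \<phi>(1) low \<gamma>t(1), of "\<delta> / 2" C] \<delta>(1) by auto
  \<comment> \<open>The three bounds serve localisation of the proximal points, their existence, and
    dominance of the proximal quadratic over the prox-regularity error, in the form
    \<open>2 * \<gamma> * \<eta> \<le> 1\<close>.\<close>
  define \<gamma> where "\<gamma> = min \<gamma>0 (min (\<gamma>t / 4) (1 / (2 * (\<eta> + 1))))"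
  have \<gamma>: "0 < \<gamma>" "\<gamma> \<le> \<gamma>0" "\<gamma> \<le> \<gamma>t / 4" using \<gamma>0 \<gamma>t(1) \<delta>(2) by (auto simp: \<gamma>_def)
  have "\<gamma> \<le> 1 / (2 * (\<eta> + 1))" by (simp add: \<gamma>_def)
  then have "\<gamma> * (2 * (\<eta> + 1)) \<le> 1" using \<delta>(2) by (simp add: pos_le_divide_eq)
  then have \<gamma>\<eta>: "2 * \<gamma> * \<eta> \<le> 1" using \<gamma>(1) by (simp add: algebra_simps)
  have small: "stationarity_measure \<gamma> (Fs (\<mu>s (q n))) \<phi> (ys (q n)) \<le> ereal (4 * \<epsilon> (q n))"
    if y: "dist (ys (q n)) x < \<delta> / 2" "dist (ys (q n)) x < 1"
      and w: "dist (ws (q n)) (- v) < \<delta>" and g: "dist (g (q n)) v < 1"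
      and \<phi>y: "\<phi> (ys (q n)) < ereal (b + \<delta>)" "\<phi> (ys (q n)) < ereal (b + 1)" for n
  proof -
    define z where "z = ys (q n)"
    obtain p where p: "p \<in> prox \<gamma> \<phi> (z - \<gamma> *\<^sub>R g (q n))"
      using prox_nonempty[OF \<phi> low \<gamma>(1,3)] by blast
    have "norm z \<le> C" using norm_triangle_sub[of z x] y by (simp add: C_def z_def dist_norm)
    moreover have "norm (g (q n)) \<le> C"
      using norm_triangle_sub[of "g (q n)" v] g by (simp add: C_def dist_norm)
    moreover have "\<phi> z \<le> ereal C"
    proof -
      have "b + 1 \<le> C" by (simp add: C_def)
      then have "ereal (b + 1) \<le> ereal C" by simp
      with \<phi>y(2) show ?thesis unfolding z_def by (rule less_imp_le[OF less_le_trans])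
    qed
    \<comment> \<open>Together with \<open>z\<close> being within \<open>\<delta> / 2\<close> of
      \<open>x\<close>, this places \<open>p\<close> in the ball where it can serve as test point
      for prox-regularity.\<close>
    ultimately have pz: "norm (p - z) < \<delta> / 2" using near[OF \<gamma>(1,2) _ _ _ p] by blast
    have "z \<in> edom \<phi>" using ws(1) by (auto simp: z_def frechet_subdiff_def)
    with \<phi>(1) obtain bz where bz: "\<phi> z = ereal bz" by (rule edom_finiteE)
    have "p \<in> edom \<phi>" by (rule prox_in_edom[OF p \<phi>(3)])
    with \<phi>(1) obtain bp where bp: "\<phi> p = ereal bp" by (rule edom_finiteE)
    define d where "d = norm (p - z)"
    have "dist x p \<le> dist x z + dist z p" by (rule dist_triangle)
    also have "\<dots> < \<delta>" using pz y(1) by (simp add: z_def dist_norm norm_minus_commute)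
    finally have "p \<in> ball x \<delta>" by simp
    moreover have "z \<in> ball x \<delta>" "\<phi> z < \<phi> x + ereal \<delta>" "ws (q n) \<in> limiting_subdiff \<phi> z \<inter> ball (- v) \<delta>"
      using y(1) \<phi>y(1) b w ws(1) frechet_subset_limiting_subdiff \<delta>(1)
      by (auto simp: z_def dist_commute)
    ultimately have "\<phi> z + ereal (ws (q n) \<bullet> (p - z) - \<eta> / 2 * d\<^sup>2) \<le> \<phi> p"
      using reg unfolding d_def by blast
    then have "bz + ws (q n) \<bullet> (p - z) - \<eta> / 2 * d\<^sup>2 \<le> bp" using bz bp by simp
    moreover have "bp + g (q n) \<bullet> (p - z) + d\<^sup>2 / (2 * \<gamma>) \<le> bz"
      using prox_descent[OF p \<gamma>(1) bp bz] by (simp add: d_def)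
    \<comment> \<open>Adding the prox-regularity and descent inequalities cancels the values of
      \<open>\<phi>\<close>; the linear terms combine to the inner product with the small vector
      \<open>e n\<close>.\<close>
    ultimately have "d\<^sup>2 / (2 * \<gamma>) - \<eta> / 2 * d\<^sup>2 \<le> - (e n \<bullet> (p - z))"
      by (simp add: e_def inner_add_left)
    also have "\<dots> \<le> norm (e n) * d" using Cauchy_Schwarz_ineq2[of "e n" "p - z"] by (simp add: d_def)
    also have "\<dots> \<le> \<epsilon> (q n) * d" using en by (intro mult_right_mono) (auto simp: d_def)
    finally have "2 * \<gamma> * (d\<^sup>2 / (2 * \<gamma>) - \<eta> / 2 * d\<^sup>2) \<le> 2 * \<gamma> * (\<epsilon> (q n) * d)"
      using \<gamma>(1) by (intro mult_left_mono) auto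
    then have "d\<^sup>2 - \<gamma> * \<eta> * d\<^sup>2 \<le> 2 * \<gamma> * (\<epsilon> (q n) * d)"
      using \<gamma>(1) by (simp add: algebra_simps)
    moreover have "\<gamma> * \<eta> * d\<^sup>2 \<le> 1 / 2 * d\<^sup>2" using \<gamma>\<eta> by (intro mult_right_mono) auto
    \<comment> \<open>Half of \<open>d\<^sup>2\<close> survives the prox-regularity error, which
      accounts for the factor 4.\<close>
    ultimately have "d * d \<le> d * (4 * \<gamma> * \<epsilon> (q n))" by (simp add: power2_eq_square algebra_simps)
    then have "d \<le> 4 * \<gamma> * \<epsilon> (q n)"
      using \<gamma>(1) \<epsilon>[of "q n"] by (cases "d = 0") (auto simp: d_def)
    then have "d / \<gamma> \<le> 4 * \<epsilon> (q n)" using \<gamma>(1) by (simp add: pos_divide_le_eq algebra_simps)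
    moreover have "norm ((z - p) /\<^sub>R \<gamma>) = d / \<gamma>"
      using \<gamma>(1) by (simp add: d_def norm_minus_commute divide_inverse mult.commute)
    moreover have "g (q n) \<in> limiting_subdiff (Fs (\<mu>s (q n))) z"
      using limiting_subdiff_smoothing[OF sm \<mu>s(2) ys(1)] by (simp add: g_def z_def)
    then have "stationarity_measure \<gamma> (Fs (\<mu>s (q n))) \<phi> z \<le> ereal (norm ((z - p) /\<^sub>R \<gamma>))"
      unfolding stationarity_measure_def using p by (intro Inf_lower) blast
    moreover note \<open>stationarity_measure \<gamma> (Fs (\<mu>s (q n))) \<phi> z \<le> ereal (norm ((z - p) /\<^sub>R \<gamma>))\<close>
    ultimately show ?thesis unfolding z_def[symmetric] by (auto elim: order_trans)
  qed
  have "\<forall>\<^sub>F n in sequentially. stationarity_measure \<gamma> (Fs (\<mu>s (q n))) \<phi> (ys (q n)) \<le> ereal (4 * \<epsilon> (q n))"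
  proof -
    have "\<forall>\<^sub>F n in sequentially. dist (ys (q n)) x < min (\<delta> / 2) 1"
      by (rule tendstoD[OF yq]) (use \<delta>(1) in simp)
    moreover have "\<forall>\<^sub>F n in sequentially. \<phi> (ys (q n)) < ereal (b + min \<delta> 1)"
      by (rule order_tendstoD(2)[OF \<phi>q]) (use b \<delta>(1) in simp)
    moreover note tendstoD[OF wq \<delta>(1)] tendstoD[OF gq zero_less_one]
    ultimately show ?thesis
    proof eventually_elim
      case (elim n)
      have "ereal (b + min \<delta> 1) \<le> ereal (b + \<delta>)" "ereal (b + min \<delta> 1) \<le> ereal (b + 1)"
        by simp_all
      then have "\<phi> (ys (q n)) < ereal (b + \<delta>)" "\<phi> (ys (q n)) < ereal (b + 1)"
        using elim(2) by (blast intro: less_le_trans)+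
      then show ?case using elim by (intro small) simp_all
    qed
  qed
  then have "(\<lambda>n. stationarity_measure \<gamma> (Fs (\<mu>s (q n))) \<phi> (ys (q n))) \<longlonglongrightarrow> 0"
  proof (rule tendsto_sandwich[where f = "\<lambda>_. 0", rotated])
    show "(\<lambda>n. ereal (4 * \<epsilon> (q n))) \<longlonglongrightarrow> 0"
      using tendsto_mult_right_zero[OF \<epsilon>q, of 4] by (simp add: zero_ereal_def)
  qed (simp_all add: stationarity_measure_nonneg)
  then show ?thesis
    using ys(1) yq \<mu>s(2) decreases_to_zero_subseq[OF \<mu>s(1) q] \<gamma> \<gamma>t(1)
    by (intro exI[of _ "\<lambda>n. ys (q n)"] exI[of _ "\<lambda>n. \<mu>s (q n)"] exI[of _ \<gamma>]) simp
qed

theorem theorem3p16: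
  fixes F \<phi> :: "'a::euclidean_space \<Rightarrow> ereal"
    and Fs :: "real \<Rightarrow> 'a \<Rightarrow> ereal"
    and \<gamma>\<phi> \<mu>t :: ereal and \<gamma>t :: real and xstar :: 'a
  assumes "proper_fun F" and "lower_semicontinuous F"
    and "proper_fun \<phi>" and "lower_semicontinuous \<phi>"
    and "(INF x. F x + \<phi> x) > -\<infinity>"
    and "\<forall>x\<in>interior (edom F). locally_lipschitz_at F x"
    and "convex (edom F)"
    and "edom \<phi> \<subseteq> interior (edom F)"
    and "prox_bounded_with \<phi> \<gamma>\<phi>"
    and "\<forall>x\<in>interior (edom F). lower_regular_at F x"
    and "\<forall>x\<in>edom \<phi>. prox_regular_at \<phi> x"
    and "\<forall>x\<in>edom \<phi>. outer_semicontinuous_at (limiting_subdiff \<phi>) x"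
    and "0 < \<mu>t" and "smoothing_function F \<mu>t Fs"
    and "0 < \<gamma>t" and "ereal \<gamma>t < \<gamma>\<phi>"
    and "xstar \<in> edom \<phi>"
  shows "frechet_stationary F \<phi> xstar \<longleftrightarrow>
    (\<exists>(xs :: nat \<Rightarrow> 'a) (\<mu>s :: nat \<Rightarrow> real) (\<gamma>s :: nat \<Rightarrow> real).
       (\<forall>n. xs n \<in> interior (edom F)) \<and> xs \<longlonglongrightarrow> xstar \<and>
       (\<forall>n. \<mu>s n \<in> param_range \<mu>t) \<and> decreases_to_zero \<mu>s \<and>
       (\<forall>n. 0 < \<gamma>s n \<and> \<gamma>s n \<le> \<gamma>t) \<and>
       liminf (\<lambda>n. stationarity_measure (\<gamma>s n) (Fs (\<mu>s n)) \<phi> (xs n)) = 0)"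
    (is "?stat \<longleftrightarrow> ?seq")
proof
  have F: "no_minus_infinity F" and \<phi>: "no_minus_infinity \<phi>"
    using assms(1,3) by (auto simp: proper_fun_def)
  have x: "xstar \<in> interior (edom F)" using assms by blast
  {
    assume ?stat
    then obtain xs \<mu>s \<gamma> where *: "\<forall>n. xs n \<in> interior (edom F)" "xs \<longlonglongrightarrow> xstar"
      "\<forall>n. \<mu>s n \<in> param_range \<mu>t" "decreases_to_zero \<mu>s" "0 < \<gamma>" "\<gamma> \<le> \<gamma>t"
      "(\<lambda>n. stationarity_measure \<gamma> (Fs (\<mu>s n)) \<phi> (xs n)) \<longlonglongrightarrow> 0"
      using measure_vanishes_if_stationary[OF assms(14,13) \<phi> assms(4,17) F _ x assms(9) _ assms(15,16)]
        assms(6,11,17) x by blast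
    \<comment> \<open>The construction gives outright convergence of the measure with a constant
      proximal parameter, which is more than a vanishing lower limit.\<close>
    have "liminf (\<lambda>n. stationarity_measure \<gamma> (Fs (\<mu>s n)) \<phi> (xs n)) = 0"
      using *(7) by (intro lim_imp_Liminf) auto
    then show ?seq
      using * by (intro exI[of _ xs] exI[of _ \<mu>s] exI[of _ "\<lambda>_. \<gamma>"]) auto
  next
    assume ?seq
    then obtain xs \<mu>s \<gamma>s where *: "\<And>n. xs n \<in> interior (edom F)" "xs \<longlonglongrightarrow> xstar"
       "\<And>n. \<mu>s n \<in> param_range \<mu>t" "decreases_to_zero \<mu>s" "\<And>n. 0 < \<gamma>s n" "\<And>n. \<gamma>s n \<le> \<gamma>t"
       "liminf (\<lambda>n. stationarity_measure (\<gamma>s n) (Fs (\<mu>s n)) \<phi> (xs n)) = 0"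
      by (elim exE conjE) (rule that, simp_all)
    obtain v where "v \<in> limiting_subdiff F xstar" "- v \<in> limiting_subdiff \<phi> xstar"
      using limiting_inclusion_if_measure_vanishes[OF assms(14) \<phi> assms(17) _ x _ *] assms(6,12,17) x
      by blast
    then show ?stat
      using frechet_stationary_if_limiting_inclusion[OF F \<phi> assms(17)] assms(10,11,17) x by blast
  }
qed

end
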